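(* Consider the Nicholson equation $$x'(t)=\beta(t)\Big(\sum_{j=1}^m p_j\,x(t-\tau_j(t))\,e^{-a_j x(t-\sigma_j(t))}-\delta x(t)\Big),\qquad t\ge t_0,$$ where $m\ge 1$, $p_j,a_j,\delta\in(0,\infty)$, and $\beta,\sigma_j,\tau_j:[t_0,\infty)\to[0,\infty)$ are continuous and bounded ($1\le j\le m$) with $\inf_{t\ge t_0}\beta(t)>0$. Let $p=\sum_{j=1}^m p_j$, $a^+=\max_j a_j$, $a^-=\min_j a_j$, and $$\zeta_M=\max_{1\le j\le m}\limsup_{t\to\infty}\int_{t-\sigma_j(t)}^t\beta(s)\,ds.$$ Assume $p>\delta$, and let $K>0$ be the unique positive solution of $\sum_{j=1}^m p_je^{-a_jK}=\delta$. Assume that $$\frac{a^+}{a^-}<\frac32\qquad\text{and}\qquad a^+K(e^{\delta\zeta_M}-1)\le 1.$$ Then the equilibrium $K$ is globally attractive, i.e. $\lim_{t\to\infty}x(t)=K$ for every solution $x(t)$ with initial condition in $C_0^+$.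
   Context: Let $\tau=\max\{\sup_{t\ge t_0}\tau_j(t),\ \sup_{t\ge t_0}\sigma_j(t): 1\le j\le m\}$. The phase space is $C=C([-\tau,0];\mathbb{R})$ with the supremum norm, and the set of admissible initial conditions is $C_0^+=\{\phi\in C:\phi(\theta)\ge 0\text{ for }\theta\in[-\tau,0),\ \phi(0)>0\}$. The solution with initial condition $\phi\in C_0^+$ is the solution on $[t_0,\infty)$ with $x(t_0+\theta)=\phi(\theta)$ for $\theta\in[-\tau,0]$; such solutions are defined and positive on $[t_0,\infty)$. *)

theory Defs
  imports "HOL-Analysis.Analysis"
begin

text \<open>
  All functions of time are total functions on \<^typ>\<open>real\<close>; only their values on
  \<open>[t0, \<infinity>)\<close> (for a solution, on \<open>[t0 - r, \<infinity>)\<close>, where \<open>r\<close> is the maximal delay) matter.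
  The index \<open>j\<close> ranges over \<open>{1..m}\<close>.
\<close>

definition max_delay ::
  "real \<Rightarrow> nat \<Rightarrow> (nat \<Rightarrow> real \<Rightarrow> real) \<Rightarrow> (nat \<Rightarrow> real \<Rightarrow> real) \<Rightarrow> real" where
  "max_delay t0 m \<tau> \<sigma> =
     Max ((\<lambda>j. max (SUP t\<in>{t0..}. \<tau> j t) (SUP t\<in>{t0..}. \<sigma> j t)) ` {1..m})"

definition admissible_initial :: "real \<Rightarrow> (real \<Rightarrow> real) set" where
  "admissible_initial r =
     {\<phi>. continuous_on {-r..0} \<phi> \<and> (\<forall>\<theta>\<in>{-r..<0}. \<phi> \<theta> \<ge> 0) \<and> \<phi> 0 > 0}"

text \<open>The derivative at \<open>t0\<close> is the right-hand one.\<close>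

definition nicholson_solution ::
  "real \<Rightarrow> nat \<Rightarrow> (real \<Rightarrow> real) \<Rightarrow> (nat \<Rightarrow> real) \<Rightarrow> (nat \<Rightarrow> real) \<Rightarrow> real \<Rightarrow>
   (nat \<Rightarrow> real \<Rightarrow> real) \<Rightarrow> (nat \<Rightarrow> real \<Rightarrow> real) \<Rightarrow>
   (real \<Rightarrow> real) \<Rightarrow> (real \<Rightarrow> real) \<Rightarrow> bool" where
  "nicholson_solution t0 m \<beta> p a \<delta> \<tau> \<sigma> \<phi> x \<longleftrightarrow>
     (\<forall>\<theta>\<in>{- max_delay t0 m \<tau> \<sigma>..0}. x (t0 + \<theta>) = \<phi> \<theta>) \<and>
     (\<forall>t\<ge>t0. (x has_real_derivative
        \<beta> t * ((\<Sum>j=1..m. p j * x (t - \<tau> j t) * exp (- a j * x (t - \<sigma> j t))) - \<delta> * x t))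
        (at t within {t0..}))"

definition globally_attractive ::
  "real \<Rightarrow> nat \<Rightarrow> (real \<Rightarrow> real) \<Rightarrow> (nat \<Rightarrow> real) \<Rightarrow> (nat \<Rightarrow> real) \<Rightarrow> real \<Rightarrow>
   (nat \<Rightarrow> real \<Rightarrow> real) \<Rightarrow> (nat \<Rightarrow> real \<Rightarrow> real) \<Rightarrow> real \<Rightarrow> bool" where
  "globally_attractive t0 m \<beta> p a \<delta> \<tau> \<sigma> K \<longleftrightarrow>
     (\<forall>\<phi>\<in>admissible_initial (max_delay t0 m \<tau> \<sigma>). \<forall>x.
        nicholson_solution t0 m \<beta> p a \<delta> \<tau> \<sigma> \<phi> x \<longrightarrow> (x \<longlongrightarrow> K) at_top)"

text \<open>
  For bounded \<open>\<sigma> j\<close> the interval \<open>[t - \<sigma> j t, t]\<close> eventually lies in \<open>[t0, \<infinity>)\<close>, so the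
  limit superior does not depend on \<open>\<beta>\<close> below \<open>t0\<close>. It is taken in \<^typ>\<open>ereal\<close>, which is
  a complete lattice; for bounded, nonnegative and continuous \<open>\<beta>\<close> and bounded nonnegative
  \<open>\<sigma> j\<close> it is finite, so \<^const>\<open>real_of_ereal\<close> is only a change of type.
\<close>

definition zeta_M :: "nat \<Rightarrow> (real \<Rightarrow> real) \<Rightarrow> (nat \<Rightarrow> real \<Rightarrow> real) \<Rightarrow> real" where
  "zeta_M m \<beta> \<sigma> =
     Max ((\<lambda>j. real_of_ereal (Limsup at_top (\<lambda>t. ereal (integral {t - \<sigma> j t..t} \<beta>)))) ` {1..m})"

end

theory Submission
  imports Defs
begin

text \<open>
  Solutions stay between two positive constants, because at a new maximum (minimum) some
  delayed value \<open>x (t - \<sigma> j t)\<close> is at most (at least) \<open>K\<close>. Let \<open>l\<close> and \<open>L\<close> be the lower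
  and upper limits of \<open>x\<close> and \<open>q y = (\<Sum>j. p j * exp (- a j * y)) / \<delta>\<close>. At times where \<open>x\<close> is
  close to \<open>L\<close> and its derivative is almost nonnegative, the same observation and the variation
  of constants formula on \<open>[t - \<sigma> j t, t]\<close> give \<open>L \<le> (1 - \<theta>) L q(l) + \<theta> K\<close> with
  \<open>\<theta> = exp (- \<delta> \<zeta>\<^sub>M)\<close>, and dually \<open>l \<ge> (1 - \<theta>) l q(L) + \<theta> K\<close>. Since \<open>l \<le> K \<le> L\<close>, \<open>q\<close>
  may be replaced on both sides by the single exponential \<open>exp (A (K - y))\<close> with
  \<open>A = max a j\<close>. With \<open>u = A (K - l)\<close>, \<open>v = A (L - K)\<close> and \<open>\<rho> = exp (\<delta> \<zeta>\<^sub>M) - 1\<close>, so that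
  \<open>A K \<rho> \<le> 1\<close>, this gives
  \<open>ln (1 + v / (1 + \<rho> v)) \<le> u \<le> (1 - exp (- v)) / (1 + \<rho> (1 - exp (- v)))\<close>,
  which is impossible for \<open>v > 0\<close>.
\<close>

section \<open>First crossings, barriers and upper limits of real functions\<close>

lemma compact_continuous_preimage:
  fixes f :: "'a::heine_borel \<Rightarrow> 'b::topological_space"
  assumes "continuous_on S f" "compact S" "closed A"
  shows "compact (S \<inter> f -` A)"
  using assms by (auto simp: compact_eq_bounded_closed intro: continuous_closed_preimage bounded_subset)

text \<open>The set where \<open>f\<close> is nonnegative is compact, so it has a least point; by
  the intermediate value theorem \<open>f\<close> cannot be positive there.\<close>

lemma first_zero:
  fixes f :: "real \<Rightarrow> real"
  assumes cont: "continuous_on {s..t} f" and "s \<le> t" "f s < 0" "f t \<ge> 0"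
  obtains u where "s < u" "u \<le> t" "f u = 0" "\<And>v. s \<le> v \<Longrightarrow> v < u \<Longrightarrow> f v < 0"
proof -
  let ?S = "{s..t} \<inter> f -` {0..}"
  have "compact ?S"
    using cont by (intro compact_continuous_preimage) auto
  moreover have "?S \<noteq> {}" using assms by auto
  ultimately obtain u where u: "u \<in> ?S" "\<And>v. v \<in> ?S \<Longrightarrow> u \<le> v"
    using compact_attains_inf[of ?S] by blast
  have "continuous_on {s..u} f" using cont u(1) by (auto intro: continuous_on_subset)
  then obtain v where v: "s \<le> v" "v \<le> u" "f v = 0"
    using IVT'[of f s 0 u] u(1) assms by auto
  then have "v = u" using u by force
  show ?thesis
  proof
    show "s < u" "u \<le> t" "f u = 0" using v \<open>v = u\<close> u(1) assms by (auto simp: less_le)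
    show "f w < 0" if "s \<le> w" "w < u" for w
      using u that by (force simp: not_le[symmetric])
  qed
qed

text \<open>At a first zero \<open>u\<close> a negative derivative would make \<open>f\<close>
  positive just before \<open>u\<close>, where it is still negative. The hypothesis on the
  derivative may use the sign of \<open>f\<close> on all of \<open>[s, u)\<close>; for a delay
  equation this is the control over the history.\<close>

lemma barrier:
  fixes f :: "real \<Rightarrow> real"
  assumes cont: "continuous_on {s..} f" and "f s < 0" "s \<le> t"
    and deriv: "\<And>u. s < u \<Longrightarrow> f u = 0 \<Longrightarrow> (\<And>v. s \<le> v \<Longrightarrow> v < u \<Longrightarrow> f v < 0) \<Longrightarrow>
      \<exists>D<0. (f has_real_derivative D) (at u)"
  shows "f t < 0"
proof (rule ccontr)
  assume "\<not> f t < 0"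
  moreover have "continuous_on {s..t} f" using cont by (rule continuous_on_subset) auto
  ultimately obtain u where u: "s < u" "f u = 0" "\<And>v. s \<le> v \<Longrightarrow> v < u \<Longrightarrow> f v < 0"
    using first_zero[of s t f] assms(2,3) by (metis not_less)
  obtain D where "D < 0" "(f has_real_derivative D) (at u)" using deriv[OF u] by blast
  then obtain d where d: "d > 0" "\<And>h. h > 0 \<Longrightarrow> h < d \<Longrightarrow> f u < f (u - h)"
    using DERIV_neg_dec_left by blast
  \<comment> \<open>This step is short enough both for the neighbourhood of size \<open>d\<close>
    and for \<open>u - h\<close> to stay above \<open>s\<close>.\<close>
  define h where "h = min (d / 2) (u - s)"
  have "h > 0" "h < d" "s \<le> u - h" "u - h < u" using d(1) u(1) by (auto simp: h_def min_def)
  then show False using d(2)[of h] u(2) u(3)[of "u - h"] by simp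
qed

text \<open>
  If \<open>f' < - e\<close> wherever \<open>f > c\<close>, then \<open>f\<close> cannot climb above \<open>c\<close> again and so decreases
  linearly as long as it stays there.
\<close>

lemma fluctuation:
  fixes f f' :: "real \<Rightarrow> real"
  assumes cont: "continuous_on {T..} f"
    and deriv: "\<And>t. t > T \<Longrightarrow> (f has_real_derivative f' t) (at t)"
    and freq: "\<And>S. \<exists>t\<ge>S. f t > c" and "e > 0"
  shows "\<exists>t>T. f t > c \<and> f' t \<ge> - e"
proof (rule ccontr)
  assume "\<not> ?thesis"
  then have neg: "f' t < - e" if "t > T" "f t > c" for t
    using that by (meson not_le)
  have decay: "f t + e * (t - T) \<le> f T" if t: "t > T" "f t > c" for t
  proof -
    let ?S = "{T..t} \<inter> f -` {..c}"
    have cont': "continuous_on {v..t} f" if "v \<ge> T" for v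
      using cont by (rule continuous_on_subset) (use that in auto)
    have mvt: "f t + e * (t - v) \<le> f v" if v: "T \<le> v" "v < t" "\<And>w. v < w \<Longrightarrow> w < t \<Longrightarrow> f w > c" for v
    proof -
      obtain w where w: "v < w" "w < t" "f t - f v = (t - v) * f' w"
      proof -
        have "f differentiable at z" if "v < z" for z
          using v that deriv[of z] by (auto simp: real_differentiable_def)
        then have "\<exists>l z. v < z \<and> z < t \<and> (f has_real_derivative l) (at z) \<and> f t - f v = (t - v) * l"
          using v(1,2) by (intro MVT cont') auto
        then obtain l z where z: "v < z" "z < t" "(f has_real_derivative l) (at z)"
          "f t - f v = (t - v) * l" by blast
        have "l = f' z" using v(1) by (intro DERIV_unique[OF z(3) deriv]) (use z(1) in auto)
        then show ?thesis using that z by blast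
      qed
      have "f' w < - e" using neg[of w] v w by auto
      then have "(t - v) * f' w \<le> (t - v) * (- e)" using v by (intro mult_left_mono) auto
      then show ?thesis using w(3) by (simp add: algebra_simps)
    qed
    show ?thesis
    proof (cases "?S = {}")
      case True
      have "f w > c" if "T < w" "w < t" for w
      proof -
        have "w \<notin> ?S" unfolding True by simp
        then show ?thesis using that by simp
      qed
      then show ?thesis using t by (intro mvt) auto
    next
      case False
      have "compact ?S"
        using cont'[of T] by (intro compact_continuous_preimage) auto
      then obtain u where u: "u \<in> ?S" "\<And>v. v \<in> ?S \<Longrightarrow> v \<le> u"
        using compact_attains_sup[of ?S] False by blast
      have "u < t" using u(1) t by (auto simp: less_le)
      \<comment> \<open>Here \<open>u\<close> is the last time before \<open>t\<close> with
        \<open>f u \<le> c\<close>. Descent on \<open>[u, t]\<close> gives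
        \<open>f t < f u \<le> c\<close>, a contradiction, so \<open>f\<close> exceeds
        \<open>c\<close> on all of \<open>(T, t)\<close>.\<close>
      have "f t + e * (t - u) \<le> f u"
      proof (rule mvt)
        show "f w > c" if "u < w" "w < t" for w
          using u(1) u(2)[of w] that by (auto simp: not_le[symmetric])
      qed (use u(1) \<open>u < t\<close> in auto)
      moreover have "e * (t - u) > 0" using \<open>e > 0\<close> \<open>u < t\<close> by simp
      ultimately show ?thesis using u(1) t by auto
    qed
  qed
  \<comment> \<open>So late a time that linear decay has used up the excess of \<open>f T\<close>
    over \<open>c\<close>; the bound \<open>T + 1\<close> secures \<open>t > T\<close>.\<close>
  obtain t where t: "t \<ge> max (T + 1) (T + (f T - c) / e)" "f t > c" using freq by blast
  have "e * (t - T) \<ge> f T - c" using t(1) \<open>e > 0\<close> by (simp add: field_simps)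
  then show False using decay[of t] t by simp
qed

text \<open>\<open>L\<close> is the infimum of the eventual upper bounds: \<open>M\<close> makes
  this set nonempty and \<open>A\<close> bounds it below, so \<open>L\<close> is a real number.
  Applied to the negated function it also yields lower limits.\<close>

lemma ex_limsup:
  fixes f :: "real \<Rightarrow> real"
  assumes bnd: "\<And>t. t \<ge> T \<Longrightarrow> A \<le> f t" "\<And>t. t \<ge> T \<Longrightarrow> f t \<le> M"
  obtains L where "A \<le> L" "\<And>e. e > 0 \<Longrightarrow> eventually (\<lambda>t. f t < L + e) at_top"
    "\<And>e S. e > 0 \<Longrightarrow> \<exists>t\<ge>S. f t > L - e"
proof
  let ?Y = "{y. eventually (\<lambda>t. f t \<le> y) at_top}"
  have ne: "?Y \<noteq> {}" using bnd(2) unfolding eventually_at_top_linorder by blast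
  have lb: "A \<le> y" if y: "y \<in> ?Y" for y
  proof -
    obtain S where "\<And>t. t \<ge> S \<Longrightarrow> f t \<le> y"
      using y unfolding eventually_at_top_linorder by blast
    then show ?thesis using bnd(1)[of "max S T"] by (meson max.cobounded1 max.cobounded2 order_trans)
  qed
  show "A \<le> Inf ?Y" using ne lb by (intro cInf_greatest)
  have bdd: "bdd_below ?Y" using lb by (rule bdd_belowI)
  show "eventually (\<lambda>t. f t < Inf ?Y + e) at_top" if e: "e > 0" for e
  proof -
    obtain y where "y \<in> ?Y" "y < Inf ?Y + e" using cInf_lessD[OF ne, of "Inf ?Y + e"] e by auto
    then show ?thesis by (auto elim: eventually_mono)
  qed
  show "\<exists>t\<ge>S. f t > Inf ?Y - e" if "e > 0" for e S
  proof (rule ccontr)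
    assume "\<not> ?thesis"
    then have "eventually (\<lambda>t. f t \<le> Inf ?Y - e) at_top"
      unfolding eventually_at_top_linorder by (meson not_le)
    then have "Inf ?Y \<le> Inf ?Y - e" using bdd by (intro cInf_lower) auto
    then show False using that by simp
  qed
qed

section \<open>The scalar inequalities that exclude a nontrivial pair of limits\<close>

lemma exp_ge_quadratic: "x \<ge> 0 \<Longrightarrow> exp x \<ge> 1 + x + x\<^sup>2 / 2" for x :: real
  using exp_lower_Taylor_quadratic[of x] by simp

text \<open>The left side is \<open>4 * (sinh (x / 2))\<^sup>2\<close>, and \<open>sinh\<close>
  dominates the identity in absolute value.\<close>

lemma exp_add_exp_minus_ge: "exp x + exp (- x) - 2 \<ge> x\<^sup>2" for x :: real
proof -
  have "cosh (2 * (x / 2)) = 2 * (sinh (x / 2))\<^sup>2 + 1"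
    using cosh_double[of "x / 2"] cosh_square_eq[of "x / 2"] by simp
  moreover have "(x / 2)\<^sup>2 \<le> (sinh (x / 2))\<^sup>2" 
  proof -
    have *: "y \<le> sinh y" if "y \<ge> 0" for y :: real
    proof -
      have "sinh 0 - 0 \<le> sinh y - y" using that
        by (intro DERIV_nonneg_imp_nondecreasing[of 0 y "\<lambda>y. sinh y - y"])
          (auto intro!: exI derivative_eq_intros simp: cosh_real_ge_1)
      then show ?thesis by simp
    qed
    have "\<bar>x / 2\<bar> \<le> \<bar>sinh (x / 2)\<bar>" using *[of "\<bar>x / 2\<bar>"] by (cases "x \<ge> 0") (auto simp: abs_if)
    then show ?thesis by (simp only: abs_le_square_iff)
  qed
  ultimately show ?thesis by (simp add: cosh_def power2_eq_square field_simps)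
qed

text \<open>The right side minus the left side, with the logarithm split into a difference, is
  \<open>F\<close>. It vanishes at 0, and its derivative is positive on the positive axis by the two
  quadratic bounds for exponentials above.\<close>

lemma ln_mobius_gt:
  fixes r v :: real
  assumes "r \<ge> 0" "v > 0"
  shows "(1 - exp (- v)) / (1 + r * (1 - exp (- v))) < ln (1 + v / (1 + r * v))"
proof -
  define F where "F = (\<lambda>v. ln (1 + (1 + r) * v) - ln (1 + r * v)
     - (1 - exp (- v)) / (1 + r * (1 - exp (- v))))"
  have pos: "1 + r * w > 0" "1 + (1 + r) * w > 0" "1 + r * (1 - exp (- w)) > 0" if "w \<ge> 0" for w
    using that assms by (auto intro!: add_pos_nonneg mult_nonneg_nonneg)
  have deriv: "(F has_real_derivative 1 / ((1 + (1 + r) * w) * (1 + r * w))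
      - exp (- w) / (1 + r * (1 - exp (- w)))\<^sup>2) (at w)" if "w \<ge> 0" for w
  proof -
    have 1: "((\<lambda>v. ln (1 + (1 + r) * v) - ln (1 + r * v)) has_real_derivative 
        (1 + r) / (1 + (1 + r) * w) - r / (1 + r * w)) (at w)"
      using pos[OF that] by (auto intro!: derivative_eq_intros)
    have 2: "((\<lambda>v. (1 - exp (- v)) / (1 + r * (1 - exp (- v)))) has_real_derivative 
       exp (- w) / (1 + r * (1 - exp (- w)))\<^sup>2) (at w)"
      using pos(3)[OF that]
      by (auto intro!: derivative_eq_intros simp: field_simps power2_eq_square)
    have "(1 + r) / (1 + (1 + r) * w) - r / (1 + r * w) = 1 / ((1 + (1 + r) * w) * (1 + r * w))"
    proof -
      have "(1 + r) * (1 + r * w) - r * (1 + (1 + r) * w) = 1" by algebra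
      then show ?thesis using pos[OF that] by (subst diff_frac_eq) auto
    qed
    then show ?thesis unfolding F_def using DERIV_diff[OF 1 2] by simp
  qed
  have deriv_pos: "exp (- w) / (1 + r * (1 - exp (- w)))\<^sup>2 < 1 / ((1 + (1 + r) * w) * (1 + r * w))"
    if "w > 0" for w
  proof -
    \<comment> \<open>Without denominators, the two sides compare coefficientwise as polynomials in \<open>r\<close>.\<close>
    have e: "exp w * exp (- w) = 1" by (simp add: exp_minus)
    have "(1 + r * (1 - exp (- w)))\<^sup>2 * exp w = exp w + 2 * r * (exp w - 1) + r\<^sup>2 * (exp w + exp (- w) - 2)"
      using e by algebra
    moreover have "exp w > 1 + w" using exp_ge_quadratic[of w] that by (smt (verit) zero_less_power divide_pos_pos)
    moreover have "2 * r * (exp w - 1) \<ge> r * (2 * w + w\<^sup>2)"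
      using mult_left_mono[OF exp_ge_quadratic[of w], of "2 * r"] that assms by (simp add: algebra_simps)
    moreover have "r\<^sup>2 * (exp w + exp (- w) - 2) \<ge> r\<^sup>2 * w\<^sup>2"
      by (intro mult_left_mono exp_add_exp_minus_ge) auto
    moreover have "(1 + (1 + r) * w) * (1 + r * w) = 1 + w + r * (2 * w + w\<^sup>2) + r\<^sup>2 * w\<^sup>2"
      by algebra
    ultimately have "(1 + (1 + r) * w) * (1 + r * w) < (1 + r * (1 - exp (- w)))\<^sup>2 * exp w" by linarith
    then have "((1 + (1 + r) * w) * (1 + r * w)) * exp (- w) < (1 + r * (1 - exp (- w)))\<^sup>2"
      by (simp add: exp_minus field_simps)
    moreover have "(1 + (1 + r) * w) * (1 + r * w) > 0" "(1 + r * (1 - exp (- w)))\<^sup>2 > 0"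
      using pos[of w] that by auto
    ultimately show ?thesis by (simp add: divide_simps mult.commute)
  qed
  have "F 0 < F v"
  proof (rule DERIV_pos_imp_increasing_open[OF assms(2)])
    show "\<exists>y. (F has_real_derivative y) (at w) \<and> 0 < y" if "0 < w" "w < v" for w
      using deriv[of w] deriv_pos[of w] that by (intro exI conjI[OF deriv[of w]]) auto
    show "continuous_on {0..v} F"
      by (intro continuous_at_imp_continuous_on ballI DERIV_isCont[OF deriv]) simp
  qed
  moreover have "ln (1 + v / (1 + r * v)) = ln (1 + (1 + r) * v) - ln (1 + r * v)"
  proof -
    have "1 + v / (1 + r * v) = (1 + (1 + r) * v) / (1 + r * v)"
      using pos[of v] assms by (simp add: field_simps)
    then show ?thesis using pos[of v] assms by (simp add: ln_div)
  qed
  ultimately show ?thesis by (simp add: F_def)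
qed

text \<open>In the application \<open>k\<close> is \<open>A * K\<close>. Replacing
  \<open>k * r\<close> by 1 in both inequalities eliminates \<open>k\<close>; solving one for
  \<open>u\<close> and the other for \<open>exp u\<close> encloses \<open>u\<close> between the two
  sides of \<open>ln_mobius_gt\<close> in the wrong order unless \<open>v = 0\<close>.\<close>

lemma scalar_two_cycle:
  fixes k r u v :: real
  assumes "0 \<le> r" "k * r \<le> 1" "0 \<le> u" "0 \<le> v"
    and v: "v \<le> (k + v) * r * (exp u - 1)"
    and u: "u \<le> (k - u) * r * (1 - exp (- v))"
  shows "u = 0" "v = 0"
proof -
  let ?s = "1 - exp (- v)"
  have s: "?s \<ge> 0" using assms by simp
  have rs: "1 + r * ?s > 0" using s assms by (intro add_pos_nonneg) auto
  have rv: "1 + r * v > 0" using assms by (intro add_pos_nonneg) auto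
  have "u * (1 + r * ?s) \<le> (k * r) * ?s" using u by (simp add: algebra_simps)
  also have "\<dots> \<le> 1 * ?s" using s assms by (intro mult_right_mono) auto
  finally have u': "u \<le> ?s / (1 + r * ?s)" using rs by (simp add: field_simps)
  have "v \<le> (k * r + r * v) * (exp u - 1)" using v by (simp add: algebra_simps)
  also have "\<dots> \<le> (1 + r * v) * (exp u - 1)" using assms by (intro mult_right_mono) auto
  finally have v': "1 + v / (1 + r * v) \<le> exp u" using rv by (simp add: field_simps)
  have "v / (1 + r * v) \<ge> 0" using rv assms by auto
  then have "ln (1 + v / (1 + r * v)) \<le> u" using v' ln_le_cancel_iff[of "1 + v / (1 + r * v)" "exp u"] by simp
  then show "v = 0" using ln_mobius_gt[of r v] u' assms by fastforce
  then show "u = 0" using u assms by simp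
qed

section \<open>The equation as a locale, and elementary properties of its data\<close>

text \<open>
  \<open>r\<close> bounds the delays, \<open>B\<close> is a primitive of \<open>\<beta>\<close>, and \<open>\<zeta>\<close> stands for \<open>\<zeta>\<^sub>M\<close>.
\<close>

locale nicholson =
  fixes t0 r \<delta> K b0 b1 \<zeta> :: real and m :: nat and p a :: "nat \<Rightarrow> real"
    and \<beta> B :: "real \<Rightarrow> real" and \<tau> \<sigma> :: "nat \<Rightarrow> real \<Rightarrow> real" and x :: "real \<Rightarrow> real"
  assumes m_pos: "m \<ge> 1" and \<delta>_pos: "\<delta> > 0" and r_nonneg: "r \<ge> 0" and K_pos: "K > 0"
    and p_pos: "\<And>j. j \<in> {1..m} \<Longrightarrow> p j > 0"
    and a_pos: "\<And>j. j \<in> {1..m} \<Longrightarrow> a j > 0"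
    and K_eq: "(\<Sum>j=1..m. p j * exp (- a j * K)) = \<delta>"
    and b0_pos: "b0 > 0"
    and \<beta>_ge: "\<And>t. t \<ge> t0 \<Longrightarrow> b0 \<le> \<beta> t"
    and \<beta>_le: "\<And>t. t \<ge> t0 \<Longrightarrow> \<beta> t \<le> b1"
    and \<tau>_nonneg: "\<And>j t. j \<in> {1..m} \<Longrightarrow> t \<ge> t0 \<Longrightarrow> 0 \<le> \<tau> j t"
    and \<tau>_le: "\<And>j t. j \<in> {1..m} \<Longrightarrow> t \<ge> t0 \<Longrightarrow> \<tau> j t \<le> r"
    and \<sigma>_nonneg: "\<And>j t. j \<in> {1..m} \<Longrightarrow> t \<ge> t0 \<Longrightarrow> 0 \<le> \<sigma> j t"
    and \<sigma>_le: "\<And>j t. j \<in> {1..m} \<Longrightarrow> t \<ge> t0 \<Longrightarrow> \<sigma> j t \<le> r"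
    and cont_B: "continuous_on {t0..} B"
    and deriv_B: "\<And>t. t > t0 \<Longrightarrow> (B has_real_derivative \<beta> t) (at t)"
    and \<zeta>_nonneg: "\<zeta> \<ge> 0"
    and \<zeta>: "\<And>j e. j \<in> {1..m} \<Longrightarrow> e > 0 \<Longrightarrow>
      eventually (\<lambda>t. B t - B (t - \<sigma> j t) < \<zeta> + e) at_top"
    and cont_x: "continuous_on {t0 - r..} x"
    and x_init: "\<And>t. t0 - r \<le> t \<Longrightarrow> t \<le> t0 \<Longrightarrow> x t \<ge> 0"
    and x_t0: "x t0 > 0"
    and deriv_x: "\<And>t. t > t0 \<Longrightarrow> (x has_real_derivative
      \<beta> t * ((\<Sum>j=1..m. p j * x (t - \<tau> j t) * exp (- a j * x (t - \<sigma> j t))) - \<delta> * x t)) (at t)"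
begin

definition G :: "real \<Rightarrow> real" where
  "G t = (\<Sum>j=1..m. p j * x (t - \<tau> j t) * exp (- a j * x (t - \<sigma> j t)))"

text \<open>The ratio of production to loss when all delayed populations in the exponents equal
  \<open>y\<close> and the remaining factors equal the present one. It passes through 1 exactly at
  \<open>K\<close>.\<close>

definition q :: "real \<Rightarrow> real" where
  "q y = (\<Sum>j=1..m. p j * exp (- a j * y)) / \<delta>"

lemma x_deriv: "t > t0 \<Longrightarrow> (x has_real_derivative \<beta> t * (G t - \<delta> * x t)) (at t)"
  using deriv_x by (simp add: G_def)

lemma continuous_x: "s \<ge> t0 \<Longrightarrow> continuous_on {s..} x"
  using cont_x r_nonneg by (auto intro: continuous_on_subset)

lemma continuous_B: "s \<ge> t0 \<Longrightarrow> continuous_on {s..} B"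
  using cont_B by (auto intro: continuous_on_subset)

lemma \<beta>_pos: "t \<ge> t0 \<Longrightarrow> \<beta> t > 0"
  using \<beta>_ge[of t] b0_pos by simp

lemma b1_nonneg: "b1 \<ge> 0"
  using \<beta>_le[of t0] \<beta>_pos[of t0] by simp

lemma q_K: "q K = 1"
  using K_eq \<delta>_pos by (simp add: q_def)

lemma q_sum: "(\<Sum>j=1..m. p j * exp (- a j * y)) = \<delta> * q y"
  using \<delta>_pos by (simp add: q_def)

lemma q_pos: "q y > 0"
  unfolding q_def using m_pos \<delta>_pos p_pos by (intro divide_pos_pos sum_pos) auto

lemma q_strict_antimono: "y < z \<Longrightarrow> q z < q y"
  unfolding q_def using m_pos \<delta>_pos p_pos a_pos
  by (intro divide_strict_right_mono sum_strict_mono mult_strict_left_mono) auto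

lemma isCont_q: "isCont q y"
  unfolding q_def using \<delta>_pos by (intro continuous_intros) auto

lemma B_mono:
  assumes "t0 \<le> s" "s \<le> t"
  shows "B s \<le> B t"
proof (rule DERIV_nonneg_imp_increasing_open[OF assms(2)])
  show "\<exists>y. (B has_real_derivative y) (at u) \<and> 0 \<le> y" if "s < u" "u < t" for u
    using deriv_B[of u] \<beta>_pos[of u] that assms(1) by (auto intro!: exI[of _ "\<beta> u"])
  show "continuous_on {s..t} B"
    using assms by (intro continuous_on_subset[OF cont_B]) auto
qed

lemma B_diff_le: "B t - B s \<le> b1 * (t - s)" if "t0 \<le> s" "s \<le> t"
proof -
  have "b1 * s - B s \<le> b1 * t - B t"
  proof (rule DERIV_nonneg_imp_increasing_open[OF that(2)])
    show "\<exists>y. ((\<lambda>t. b1 * t - B t) has_real_derivative y) (at u) \<and> 0 \<le> y" if "s < u" "u < t" for u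
      using that \<open>t0 \<le> s\<close> \<beta>_le[of u]
      by (intro exI[of _ "b1 - \<beta> u"]) (auto intro!: derivative_eq_intros deriv_B)
    show "continuous_on {s..t} (\<lambda>t. b1 * t - B t)"
      using that by (intro continuous_intros continuous_on_subset[OF cont_B]) auto
  qed
  then show ?thesis by (simp add: algebra_simps)
qed

lemma B_delay_le:
  assumes "t0 \<le> s" "s \<le> t" "t - s \<le> r"
  shows "B t - B s \<le> b1 * r"
  using B_diff_le[OF assms(1,2)] mult_left_mono[OF assms(3) b1_nonneg] by linarith

text \<open>The barrier decays with rate \<open>\<delta> + 1\<close> in the time \<open>B\<close>,
  faster than the loss alone can force. At a first contact the extra 1 leaves the term
  \<open>- x u\<close>, so the inequality is strict even if \<open>G u = 0\<close>.\<close>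

lemma x_pos: "t \<ge> t0 \<Longrightarrow> x t > 0"
proof -
  assume t: "t \<ge> t0"
  define c where "c = x t0 / 2"
  define g where "g = (\<lambda>t. c * exp (- (\<delta> + 1) * (B t - B t0)) - x t)"
  have c: "c > 0" "c < x t0" using x_t0 by (auto simp: c_def)
  have "g t < 0"
  proof (rule barrier[where f = g and s = t0])
    show "continuous_on {t0..} g"
      unfolding g_def using continuous_x[of t0] cont_B by (auto intro!: continuous_intros)
    show "g t0 < 0" using c by (simp add: g_def)
    fix u assume u: "t0 < u" "g u = 0" "\<And>v. t0 \<le> v \<Longrightarrow> v < u \<Longrightarrow> g v < 0"
    have xu: "x u = c * exp (- (\<delta> + 1) * (B u - B t0))" using u(2) by (simp add: g_def)
    have pos: "x v \<ge> 0" if "t0 - r \<le> v" "v \<le> u" for v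
    proof -
      have "c * exp (- (\<delta> + 1) * (B v - B t0)) > 0" using c by simp
      then show ?thesis using x_init[of v] u(3)[of v] u(2) that by (force simp: g_def)
    qed
    have "x (u - \<tau> j u) \<ge> 0" if "j \<in> {1..m}" for j
      using \<tau>_nonneg[of j u] \<tau>_le[of j u] u(1) that by (intro pos) auto
    then have "G u \<ge> 0" unfolding G_def using p_pos
      by (intro sum_nonneg mult_nonneg_nonneg) (auto intro: less_imp_le)
    moreover have "x u > 0" unfolding xu using c by simp
    ultimately have neg: "\<beta> u * (- G u - x u) < 0" using \<beta>_pos[of u] u(1) by (intro mult_pos_neg) auto
    have "(g has_real_derivative c * (exp (- (\<delta> + 1) * (B u - B t0)) * (- (\<delta> + 1) * \<beta> u))
        - \<beta> u * (G u - \<delta> * x u)) (at u)"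
      unfolding g_def using u(1)
      by (auto intro!: derivative_eq_intros x_deriv deriv_B)
    moreover have "c * (exp (- (\<delta> + 1) * (B u - B t0)) * (- (\<delta> + 1) * \<beta> u)) = x u * (- (\<delta> + 1) * \<beta> u)"
      unfolding xu by simp
    moreover have "x u * (- (\<delta> + 1) * \<beta> u) - \<beta> u * (G u - \<delta> * x u) = \<beta> u * (- G u - x u)"
      by algebra
    ultimately have "(g has_real_derivative \<beta> u * (- G u - x u)) (at u)"
      by (simp only:)
    then show "\<exists>D<0. (g has_real_derivative D) (at u)" using neg by blast
  qed (use t in auto)
  moreover have "c * exp (- (\<delta> + 1) * (B t - B t0)) > 0" using c by simp
  ultimately show ?thesis by (simp add: g_def)
qed

lemma x_nonneg: "t \<ge> t0 - r \<Longrightarrow> x t \<ge> 0"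
  using x_pos x_init by (meson less_imp_le linear)

section \<open>Variation of constants and bounds on the production term\<close>

text \<open>In the time \<open>B\<close> the loss rate is the constant \<open>\<delta>\<close>, so
  \<open>exp (\<delta> * B u)\<close> is an integrating factor. What is left has the sign of
  \<open>G u - \<delta> * C\<close>.\<close>

lemma comparison_deriv:
  assumes "u > t0"
  shows "((\<lambda>u. (x u - C) * exp (\<delta> * B u)) has_real_derivative
    \<beta> u * exp (\<delta> * B u) * (G u - \<delta> * C)) (at u)"
  using assms by (auto intro!: derivative_eq_intros x_deriv deriv_B simp: algebra_simps)

lemma comparison_continuous:
  assumes "t0 \<le> s"
  shows "continuous_on {s..t} (\<lambda>u. (x u - C) * exp (\<delta> * B u))"
  using assms by (intro continuous_intros continuous_on_subset[OF continuous_x[of t0]]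
     continuous_on_subset[OF cont_B]) auto

lemma exp_B_diff: "exp (\<delta> * B s) = exp (- \<delta> * (B t - B s)) * exp (\<delta> * B t)"
  by (simp add: exp_add[symmetric] algebra_simps)

text \<open>The weighted deviation from \<open>C\<close> does not increase. Keeping the term with
  \<open>x s\<close> matters: a start below \<open>C\<close> still pulls \<open>x t\<close> below
  \<open>C\<close>.\<close>

lemma upper_comparison:
  assumes "t0 \<le> s" "s \<le> t" and G: "\<And>u. s < u \<Longrightarrow> u < t \<Longrightarrow> G u \<le> \<delta> * C"
  shows "x t \<le> C + (x s - C) * exp (- \<delta> * (B t - B s))"
proof -
  have "(x t - C) * exp (\<delta> * B t) \<le> (x s - C) * exp (\<delta> * B s)"
  proof (rule DERIV_nonpos_imp_decreasing_open[OF assms(2)])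
    show "\<exists>y. ((\<lambda>u. (x u - C) * exp (\<delta> * B u)) has_real_derivative y) (at u) \<and> y \<le> 0"
      if "s < u" "u < t" for u
    proof -
      have "\<beta> u * exp (\<delta> * B u) * (G u - \<delta> * C) \<le> 0"
        using that assms(1) G[of u] \<beta>_pos[of u] by (intro mult_nonneg_nonpos) auto
      then show ?thesis using comparison_deriv[of u C] that assms(1) by auto
    qed
  qed (use assms in \<open>auto intro: comparison_continuous\<close>)
  also have "\<dots> = ((x s - C) * exp (- \<delta> * (B t - B s))) * exp (\<delta> * B t)"
    by (subst exp_B_diff[of s t]) simp
  finally have "x t - C \<le> (x s - C) * exp (- \<delta> * (B t - B s))"
    by (simp only: mult_le_cancel_right exp_gt_zero)
  then show ?thesis by simp
qed

lemma lower_comparison: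
  assumes "t0 \<le> s" "s \<le> t" and G: "\<And>u. s < u \<Longrightarrow> u < t \<Longrightarrow> G u \<ge> \<delta> * C"
  shows "x t \<ge> C + (x s - C) * exp (- \<delta> * (B t - B s))"
proof -
  have "((x s - C) * exp (- \<delta> * (B t - B s))) * exp (\<delta> * B t) = (x s - C) * exp (\<delta> * B s)"
    by (subst exp_B_diff[of s t]) simp
  also have "\<dots> \<le> (x t - C) * exp (\<delta> * B t)"
  proof (rule DERIV_nonneg_imp_increasing_open[OF assms(2)])
    show "\<exists>y. ((\<lambda>u. (x u - C) * exp (\<delta> * B u)) has_real_derivative y) (at u) \<and> 0 \<le> y"
      if "s < u" "u < t" for u
    proof -
      have "\<beta> u * exp (\<delta> * B u) * (G u - \<delta> * C) \<ge> 0"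
        using that assms(1) G[of u] \<beta>_pos[of u] by (intro mult_nonneg_nonneg) auto
      then show ?thesis using comparison_deriv[of u C] that assms(1) by auto
    qed
  qed (use assms in \<open>auto intro: comparison_continuous\<close>)
  finally have "(x s - C) * exp (- \<delta> * (B t - B s)) \<le> x t - C"
    by (simp only: mult_le_cancel_right exp_gt_zero)
  then show ?thesis by simp
qed

lemma delayed_ge: "j \<in> {1..m} \<Longrightarrow> t0 \<le> u \<Longrightarrow> u - r \<le> u - \<tau> j u \<and> u - r \<le> u - \<sigma> j u"
  using \<tau>_le \<sigma>_le by simp

lemma G_nonneg:
  assumes "u \<ge> t0"
  shows "G u \<ge> 0"
  unfolding G_def
proof (intro sum_nonneg mult_nonneg_nonneg)
  fix j assume "j \<in> {1..m}"
  then show "0 \<le> p j" "0 \<le> x (u - \<tau> j u)"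
    using p_pos[of j] delayed_ge[of j u] assms by (auto intro: x_nonneg)
qed simp

text \<open>This is \<open>lower_comparison\<close> with \<open>C = 0\<close>, and \<open>B\<close>
  grows by at most \<open>b1 * r\<close> over one delay.\<close>

lemma x_decay:
  assumes "t0 \<le> s" "s \<le> t" "t - s \<le> r"
  shows "x s * exp (- \<delta> * (b1 * r)) \<le> x t"
proof -
  have "x s * exp (- \<delta> * (B t - B s)) \<le> x t"
    using lower_comparison[OF assms(1,2), of 0] G_nonneg assms by simp
  moreover have "x s * exp (- \<delta> * (b1 * r)) \<le> x s * exp (- \<delta> * (B t - B s))"
    using B_delay_le[OF assms] \<delta>_pos x_pos[of s] assms by (intro mult_left_mono) auto
  ultimately show ?thesis by simp
qed

text \<open>The two delays play separate roles: \<open>M\<close> bounds the linear factors, while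
  \<open>y\<close> enters through the decreasing exponentials. Thus \<open>y\<close> can be near
  \<open>K\<close> or near the lower limit while \<open>M\<close> is near the upper limit.\<close>

lemma G_upper:
  assumes "u \<ge> t0" "\<And>v. u - r \<le> v \<Longrightarrow> v \<le> u \<Longrightarrow> x v \<le> M" "\<And>j. j \<in> {1..m} \<Longrightarrow> y \<le> x (u - \<sigma> j u)"
  shows "G u \<le> M * (\<delta> * q y)"
proof -
  have M: "M \<ge> 0" using assms(2)[of u] x_pos[of u] assms(1) r_nonneg by simp
  have "G u \<le> (\<Sum>j=1..m. p j * M * exp (- a j * y))"
    unfolding G_def
  proof (rule sum_mono)
    fix j assume j: "j \<in> {1..m}"
    have "x (u - \<tau> j u) \<le> M" "0 \<le> x (u - \<tau> j u)"
      using \<tau>_nonneg[of j u] \<tau>_le[of j u] assms j x_nonneg[of "u - \<tau> j u"] by auto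
    then show "p j * x (u - \<tau> j u) * exp (- a j * x (u - \<sigma> j u)) \<le> p j * M * exp (- a j * y)"
      using p_pos[OF j] a_pos[OF j] assms(3)[OF j] M by (intro mult_mono) auto
  qed
  also have "\<dots> = M * (\<delta> * q y)"
    unfolding q_sum[symmetric] sum_distrib_left by (simp add: mult_ac)
  finally show ?thesis .
qed

lemma G_lower:
  assumes "u \<ge> t0" "\<And>v. u - r \<le> v \<Longrightarrow> v \<le> u \<Longrightarrow> M \<le> x v" "\<And>j. j \<in> {1..m} \<Longrightarrow> x (u - \<sigma> j u) \<le> y"
  shows "M * (\<delta> * q y) \<le> G u"
proof -
  have "M * (\<delta> * q y) = (\<Sum>j=1..m. p j * M * exp (- a j * y))"
    unfolding q_sum[symmetric] sum_distrib_left by (simp add: mult_ac)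
  also have "\<dots> \<le> G u"
    unfolding G_def
  proof (rule sum_mono)
    fix j assume j: "j \<in> {1..m}"
    have "M \<le> x (u - \<tau> j u)" "0 \<le> x (u - \<tau> j u)" 
      using \<tau>_nonneg[of j u] \<tau>_le[of j u] assms j x_nonneg[of "u - \<tau> j u"] by auto
    then have "p j * M * exp (- a j * y) \<le> p j * x (u - \<tau> j u) * exp (- a j * y)"
      using p_pos[OF j] by (intro mult_right_mono mult_left_mono) auto
    also have "\<dots> \<le> p j * x (u - \<tau> j u) * exp (- a j * x (u - \<sigma> j u))"
      using p_pos[OF j] a_pos[OF j] assms(3)[OF j] \<open>0 \<le> x (u - \<tau> j u)\<close> by (intro mult_left_mono) auto
    finally show "p j * M * exp (- a j * y) \<le> p j * x (u - \<tau> j u) * exp (- a j * x (u - \<sigma> j u))" .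
  qed
  finally show ?thesis .
qed

section \<open>Boundedness and persistence of the solution\<close>

text \<open>The exponential barrier grows as if nothing were lost and all exponentials equalled 1.
  At a first contact \<open>x u\<close> is the maximum over the preceding delay window, and the
  neglected loss \<open>\<delta> * x u\<close> makes the derivative strictly negative.\<close>

lemma growth:
  assumes "t0 \<le> s" "s \<le> t" "\<And>v. s - r \<le> v \<Longrightarrow> v \<le> s \<Longrightarrow> x v < A"
  shows "x t \<le> A * exp (\<delta> * q 0 * (B t - B s))"
proof -
  let ?E = "\<lambda>t. A * exp (\<delta> * q 0 * (B t - B s))"
  have A: "A > 0" using assms(3)[of s] x_pos[of s] assms(1) r_nonneg by simp
  have "x t - ?E t < 0"
  proof (rule barrier[where f = "\<lambda>t. x t - ?E t" and s = s])
    show "continuous_on {s..} (\<lambda>t. x t - ?E t)"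
      using continuous_x[OF assms(1)] continuous_B[OF assms(1)] by (auto intro!: continuous_intros)
    show "x s - ?E s < 0" using assms(3)[of s] r_nonneg by simp
    fix u assume u: "s < u" "x u - ?E u = 0" "\<And>v. s \<le> v \<Longrightarrow> v < u \<Longrightarrow> x v - ?E v < 0"
    have "x v \<le> x u" if "u - r \<le> v" "v \<le> u" for v
    proof (cases "v \<le> s")
      case True
      then have "x v < A" using assms(3)[of v] u(1) that by auto
      also have "A * exp 0 \<le> ?E u" using A u(1) B_mono[of s u] assms(1) \<delta>_pos q_pos[of 0]
        by (intro mult_left_mono) auto
      finally show ?thesis using u(2) by simp
    next
      case False
      have "?E v \<le> ?E u" using A False that B_mono[of v u] assms(1) \<delta>_pos q_pos[of 0] by simp
      then show ?thesis using u(2) u(3)[of v] False that by (cases "v = u") auto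
    qed
    then have "G u \<le> x u * (\<delta> * q 0)"
    proof (rule G_upper[rotated])
      show "0 \<le> x (u - \<sigma> j u)" if "j \<in> {1..m}" for j
        using assms(1) u(1) x_nonneg[of "u - \<sigma> j u"] delayed_ge[of j u] that by simp
    qed (use assms(1) u(1) in auto)
    moreover have "\<delta> * x u > 0" using \<delta>_pos x_pos[of u] u(1) assms(1) by simp
    ultimately have "G u - \<delta> * x u - \<delta> * q 0 * x u < 0" by (simp only: mult_ac)
    then have neg: "\<beta> u * (G u - \<delta> * x u - \<delta> * q 0 * x u) < 0"
      using \<beta>_pos[of u] u(1) assms(1) by (intro mult_pos_neg) auto
    have "((\<lambda>t. x t - ?E t) has_real_derivative
        \<beta> u * (G u - \<delta> * x u) - ?E u * (\<delta> * q 0 * \<beta> u)) (at u)"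
      using u(1) assms(1) by (auto intro!: derivative_eq_intros x_deriv deriv_B)
    moreover have "?E u = x u" using u(2) by simp
    moreover have "\<beta> u * (G u - \<delta> * x u) - x u * (\<delta> * q 0 * \<beta> u) =
        \<beta> u * (G u - \<delta> * x u - \<delta> * q 0 * x u)"
      by algebra
    ultimately have "((\<lambda>t. x t - ?E t) has_real_derivative
       \<beta> u * (G u - \<delta> * x u - \<delta> * q 0 * x u)) (at u)"
      by (simp only:)
    then show "\<exists>D<0. ((\<lambda>t. x t - ?E t) has_real_derivative D) (at u)" using neg by blast
  qed (use assms in auto)
  then show ?thesis by simp
qed

text \<open>
  At a new maximum \<open>u\<close> some \<open>s = u - \<sigma> j u\<close> has \<open>x s \<le> K\<close>. As \<open>x\<close> decays at most
  exponentially, it is bounded by \<open>A\<close> on \<open>[s - r, s]\<close>, and hence grows at most to \<open>M0\<close>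
  on \<open>[s, u]\<close>.
\<close>

lemma bounded_above: obtains M where "\<And>t. t \<ge> t0 \<Longrightarrow> x t \<le> M"
proof -
  \<comment> \<open>The summand 1 supplies the strict inequality that \<open>growth\<close> demands
    on the initial window.\<close>
  define A where "A = K * exp (\<delta> * (b1 * r)) + 1"
  define M0 where "M0 = A * exp (\<delta> * q 0 * (b1 * r))"
  have "A > 0" using K_pos by (simp add: A_def add_pos_pos)
  \<comment> \<open>Compactness bounds \<open>x\<close> up to \<open>t0 + 2 * r\<close>. Later
    contacts satisfy \<open>s - r \<ge> t0\<close>, so \<open>x_decay\<close> covers the whole
    window before \<open>s\<close>.\<close>
  obtain w where w: "w \<in> {t0 - r..t0 + 2 * r}" "\<And>v. v \<in> {t0 - r..t0 + 2 * r} \<Longrightarrow> x v \<le> x w"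
    using continuous_attains_sup[of "{t0 - r..t0 + 2 * r}" x] r_nonneg
      continuous_on_subset[OF cont_x, of "{t0 - r..t0 + 2 * r}"] by auto
  define M where "M = max M0 (x w) + 1"
  have M: "M > M0" "\<And>v. t0 - r \<le> v \<Longrightarrow> v \<le> t0 + 2 * r \<Longrightarrow> x v < M"
    using w(2) by (force simp: M_def)+
  have "x t - M < 0" if "t \<ge> t0 + 2 * r" for t
  proof (rule barrier[where f = "\<lambda>t. x t - M" and s = "t0 + 2 * r"])
    show "continuous_on {t0 + 2 * r..} (\<lambda>t. x t - M)"
      using continuous_x[of "t0 + 2 * r"] r_nonneg by (auto intro!: continuous_intros)
    show "x (t0 + 2 * r) - M < 0" using M(2)[of "t0 + 2 * r"] r_nonneg by simp
    fix u assume u: "t0 + 2 * r < u" "x u - M = 0" "\<And>v. t0 + 2 * r \<le> v \<Longrightarrow> v < u \<Longrightarrow> x v - M < 0"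
    have "G u - \<delta> * x u < 0"
    proof (rule ccontr)
      assume neg: "\<not> ?thesis"
      have le: "x v \<le> M" if "t0 - r \<le> v" "v \<le> u" for v
        using M(2)[of v] u(2) u(3)[of v] that by (cases "v = u"; cases "v \<le> t0 + 2 * r") auto
      have "\<exists>j\<in>{1..m}. x (u - \<sigma> j u) \<le> K"
      proof (rule ccontr)
        assume none: "\<not> ?thesis"
        \<comment> \<open>If all these delayed values exceeded \<open>K\<close>, so would their
          minimum; then \<open>q y < 1\<close> and production falls below loss.\<close>
        define y where "y = Min ((\<lambda>j. x (u - \<sigma> j u)) ` {1..m})"
        have "y > K" unfolding y_def using none m_pos by (subst Min_gr_iff) auto
        have "G u \<le> M * (\<delta> * q y)"
          using u(1) r_nonneg by (intro G_upper le) (auto simp: y_def)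
        also have "\<dots> < M * (\<delta> * 1)"
          using q_strict_antimono[OF \<open>y > K\<close>] \<delta>_pos u x_pos[of u] r_nonneg
          by (intro mult_strict_left_mono) (auto simp: q_K)
        finally show False using neg u(2) by (simp add: mult.commute)
      qed
      then obtain j where j: "j \<in> {1..m}" "x (u - \<sigma> j u) \<le> K" by blast
      define s where "s = u - \<sigma> j u"
      have s: "s \<le> u" "u - s \<le> r" "t0 \<le> s - r"
        using \<sigma>_nonneg[OF j(1), of u] \<sigma>_le[OF j(1), of u] u(1) r_nonneg by (auto simp: s_def)
      have "x v < A" if "s - r \<le> v" "v \<le> s" for v
      proof -
        have "x v * exp (- \<delta> * (b1 * r)) \<le> K"
          using x_decay[of v s] s that j(2) by (simp add: s_def)
        then have "x v \<le> K * exp (\<delta> * (b1 * r))" by (simp add: exp_minus field_simps)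
        then show ?thesis by (simp add: A_def)
      qed
      then have "x u \<le> A * exp (\<delta> * q 0 * (B u - B s))"
        using s r_nonneg by (intro growth) auto
      also have "\<dots> \<le> M0" unfolding M0_def
        using B_delay_le[of s u] s r_nonneg \<open>A > 0\<close> \<delta>_pos q_pos[of 0] by (intro mult_left_mono) auto
      finally show False using M(1) u(2) by simp
    qed
    then show "\<exists>D<0. ((\<lambda>t. x t - M) has_real_derivative D) (at u)"
      using \<beta>_pos[of u] u(1) r_nonneg
      by (intro exI[of _ "\<beta> u * (G u - \<delta> * x u)"]) (auto intro!: mult_pos_neg derivative_eq_intros x_deriv)
  qed (use that in auto)
  then have "x t \<le> M" if "t \<ge> t0" for t using M(2)[of t] that r_nonneg by (cases "t \<ge> t0 + 2 * r") force+
  then show ?thesis using that by blast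
qed

text \<open>At a new minimum some delayed value is at least \<open>K\<close>, and by
  \<open>x_decay\<close> the solution cannot have fallen from there to \<open>c\<close>. Halving in
  the definition of \<open>c\<close> makes it strictly smaller than both this decay bound and the
  minimum over the first window.\<close>

lemma bounded_below: obtains c where "c > 0" "\<And>t. t \<ge> t0 \<Longrightarrow> c \<le> x t"
proof -
  obtain w where w: "w \<in> {t0..t0 + r}" "\<And>v. v \<in> {t0..t0 + r} \<Longrightarrow> x w \<le> x v"
    using continuous_attains_inf[of "{t0..t0 + r}" x] r_nonneg
      continuous_on_subset[OF cont_x, of "{t0..t0 + r}"] by auto
  define c where "c = min (K * exp (- \<delta> * (b1 * r))) (x w) / 2"
  have c: "c > 0" using K_pos x_pos[of w] w(1) by (simp add: c_def)
  then have c2: "c < K * exp (- \<delta> * (b1 * r))" "c < x w" by (auto simp: c_def)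
  have cx: "c < x v" if "t0 \<le> v" "v \<le> t0 + r" for v using w(2)[of v] that c2 by simp
  have "c - x t < 0" if "t \<ge> t0 + r" for t
  proof (rule barrier[where f = "\<lambda>t. c - x t" and s = "t0 + r"])
    show "continuous_on {t0 + r..} (\<lambda>t. c - x t)"
      using continuous_x[of "t0 + r"] r_nonneg by (auto intro!: continuous_intros)
    show "c - x (t0 + r) < 0" using cx[of "t0 + r"] r_nonneg by simp
    fix u assume u: "t0 + r < u" "c - x u = 0" "\<And>v. t0 + r \<le> v \<Longrightarrow> v < u \<Longrightarrow> c - x v < 0"
    have "G u - \<delta> * x u > 0"
    proof (rule ccontr)
      assume neg: "\<not> ?thesis"
      have ge: "c \<le> x v" if "t0 \<le> v" "v \<le> u" for v
        using cx[of v] u(2) u(3)[of v] that by (cases "v = u"; cases "v \<le> t0 + r") auto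
      have "\<exists>j\<in>{1..m}. x (u - \<sigma> j u) \<ge> K"
      proof (rule ccontr)
        assume none: "\<not> ?thesis"
        define y where "y = Max ((\<lambda>j. x (u - \<sigma> j u)) ` {1..m})"
        have "y < K" unfolding y_def using none m_pos by (subst Max_less_iff) auto
        have "c * (\<delta> * 1) < c * (\<delta> * q y)"
          using q_strict_antimono[OF \<open>y < K\<close>] \<delta>_pos c
          by (intro mult_strict_left_mono) (auto simp: q_K)
        also have "\<dots> \<le> G u"
          using u(1) r_nonneg by (intro G_lower ge) (auto simp: y_def)
        finally show False using neg u(2) by (simp add: mult.commute)
      qed
      then obtain j where j: "j \<in> {1..m}" "x (u - \<sigma> j u) \<ge> K" by blast
      have "K * exp (- \<delta> * (b1 * r)) \<le> x (u - \<sigma> j u) * exp (- \<delta> * (b1 * r))"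
        using j(2) by (intro mult_right_mono) auto
      also have "\<dots> \<le> x u"
        using \<sigma>_nonneg[OF j(1), of u] \<sigma>_le[OF j(1), of u] u(1) r_nonneg by (intro x_decay) auto
      finally show False using c2 u(2) by simp
    qed
    then show "\<exists>D<0. ((\<lambda>t. c - x t) has_real_derivative D) (at u)"
      using \<beta>_pos[of u] u(1) r_nonneg
      by (intro exI[of _ "- (\<beta> u * (G u - \<delta> * x u))"]) (auto intro!: derivative_eq_intros x_deriv)
  qed (use that in auto)
  then have "c \<le> x t" if "t \<ge> t0" for t using cx[of t] that by (cases "t \<ge> t0 + r") force+
  then show ?thesis using that c by blast
qed

section \<open>Inequalities between the lower and upper limits\<close>

lemma delay_eventually:
  assumes "\<eta> > 0"
  shows "eventually (\<lambda>t. \<forall>j\<in>{1..m}. B t - B (t - \<sigma> j t) < \<zeta> + \<eta>) at_top"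
  using \<zeta> assms by (intro eventually_ball_finite) auto

text \<open>From a delayed value near or below \<open>K\<close>, the solution relaxes towards at
  most \<open>max (L * q l) K\<close> during a \<open>B\<close>-time of about \<open>\<zeta>\<close>
  at most. The maximum with \<open>K\<close> makes the estimate available before
  \<open>l \<le> K \<le> L\<close> is known, which is itself deduced from it.\<close>

lemma limsup_estimate:
  assumes lo: "\<And>e. e > 0 \<Longrightarrow> eventually (\<lambda>t. l - e < x t) at_top"
    and up: "\<And>e. e > 0 \<Longrightarrow> eventually (\<lambda>t. x t < L + e) at_top"
    and freq: "\<And>e S. e > 0 \<Longrightarrow> \<exists>t\<ge>S. x t > L - e" and "L > 0"
  shows "L \<le> max (L * q l) K + (K - max (L * q l) K) * exp (- \<delta> * \<zeta>)"
proof -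
  define C where "C = (\<lambda>\<eta>. max ((L + \<eta>) * q (l - \<eta>)) (K + \<eta>))"
  have main: "L - \<eta> \<le> C \<eta> + (K + \<eta> - C \<eta>) * exp (- \<delta> * (\<zeta> + \<eta>))" if \<eta>: "\<eta> > 0" for \<eta>
  proof -
    \<comment> \<open>As \<open>e\<close> tends to 0 the limit is
      \<open>L * q (K + \<eta>) - L < 0\<close>. A small \<open>e\<close> thus rules out that all
      delayed values exceed \<open>K + \<eta>\<close>; the term \<open>e / (\<delta> * b0)\<close>
      is the derivative error \<open>e\<close> divided by \<open>\<delta>\<close> and the lower
      bound of \<open>\<beta>\<close>.\<close>
    have "((\<lambda>e. (L + e) * q (K + \<eta>) - (L - e) + e / (\<delta> * b0)) \<longlongrightarrow>
        (L + 0) * q (K + \<eta>) - (L - 0) + 0 / (\<delta> * b0)) (at_right 0)"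
      using \<delta>_pos b0_pos by (intro tendsto_intros) auto
    moreover have "L * q (K + \<eta>) < L * 1"
      using q_strict_antimono[of K "K + \<eta>"] \<eta> \<open>L > 0\<close> q_K by (intro mult_strict_left_mono) auto
    ultimately have "eventually (\<lambda>e. (L + e) * q (K + \<eta>) - (L - e) + e / (\<delta> * b0) < 0) (at_right 0)"
      by (intro order_tendstoD(2)) auto
    moreover have "eventually (\<lambda>e. e < \<eta>) (at_right 0)"
      using \<eta> by (intro order_tendstoD(2)[OF tendsto_ident_at]) auto
    ultimately have "eventually (\<lambda>e. 0 < e \<and> e < \<eta> \<and>
        (L + e) * q (K + \<eta>) - (L - e) + e / (\<delta> * b0) < 0) (at_right 0)"
      using eventually_at_right_less[of "0::real"] by eventually_elim auto
    then obtain e where e: "0 < e" "e < \<eta>" "(L + e) * q (K + \<eta>) - (L - e) + e / (\<delta> * b0) < 0"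
      using eventually_happens'[OF trivial_limit_at_right_real] by blast
    have "eventually (\<lambda>t. l - \<eta> < x t \<and> x t < L + e \<and>
        (\<forall>j\<in>{1..m}. B t - B (t - \<sigma> j t) < \<zeta> + \<eta>)) at_top"
      using lo[OF \<eta>] up[OF e(1)] delay_eventually[OF \<eta>] by eventually_elim auto
    then obtain T1 where T1: "\<And>t. t \<ge> T1 \<Longrightarrow> l - \<eta> < x t \<and> x t < L + e \<and>
        (\<forall>j\<in>{1..m}. B t - B (t - \<sigma> j t) < \<zeta> + \<eta>)"
      unfolding eventually_at_top_linorder by blast
    \<comment> \<open>Two delays are needed: \<open>s\<close> lies at most \<open>r\<close> before
      \<open>t\<close>, and the delayed arguments of times in \<open>(s, t)\<close> lie at most
      \<open>r\<close> before \<open>s\<close>.\<close>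
    define T where "T = max T1 t0 + 2 * r"
    have T: "T1 + 2 * r \<le> T" "t0 + 2 * r \<le> T" by (auto simp: T_def)
    obtain t where t: "t > T" "x t > L - e" "\<beta> t * (G t - \<delta> * x t) \<ge> - e"
      using fluctuation[of T x "\<lambda>t. \<beta> t * (G t - \<delta> * x t)" "L - e" e]
        continuous_x[of T] x_deriv freq[OF e(1)] e(1) T(2) r_nonneg by auto
    have "t \<ge> t0" using t(1) T(2) r_nonneg by simp
    have "G t - \<delta> * x t \<ge> - (e / b0)"
    proof -
      have "- (e / b0) \<le> - (e / \<beta> t)"
        using \<beta>_ge[OF \<open>t \<ge> t0\<close>] b0_pos e(1) by (simp add: frac_le)
      also have "\<dots> \<le> G t - \<delta> * x t"
        using t(3) \<beta>_pos[OF \<open>t \<ge> t0\<close>] by (simp add: field_simps)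
      finally show ?thesis .
    qed
    moreover have "\<delta> * (L - e) < \<delta> * x t" using t(2) \<delta>_pos by simp
    ultimately have G: "G t > \<delta> * (L - e) - e / b0" by linarith
    have "\<exists>j\<in>{1..m}. x (t - \<sigma> j t) \<le> K + \<eta>"
    proof (rule ccontr)
      assume none: "\<not> ?thesis"
      have "G t \<le> (L + e) * (\<delta> * q (K + \<eta>))"
      proof (rule G_upper)
        show "x v \<le> L + e" if "t - r \<le> v" for v
          using T1[of v] t(1) T(1) r_nonneg that by auto
        show "K + \<eta> \<le> x (t - \<sigma> j t)" if "j \<in> {1..m}" for j
          using none that by (meson less_imp_le not_le)
      qed (rule \<open>t \<ge> t0\<close>)
      also have "\<dots> < \<delta> * (L - e) - e / b0"
        using mult_strict_left_mono[OF e(3) \<delta>_pos] \<delta>_pos b0_pos by (simp add: algebra_simps)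
      finally show False using G by simp
    qed
    then obtain j where j: "j \<in> {1..m}" "x (t - \<sigma> j t) \<le> K + \<eta>" by blast
    define s where "s = t - \<sigma> j t"
    have s: "s \<le> t" "t - s \<le> r" "t0 \<le> s" "T1 + r \<le> s"
      using \<sigma>_nonneg[OF j(1) \<open>t \<ge> t0\<close>] \<sigma>_le[OF j(1) \<open>t \<ge> t0\<close>] t(1) T r_nonneg by (auto simp: s_def)
    have "G u \<le> \<delta> * C \<eta>" if "s < u" "u < t" for u
    proof -
      have "G u \<le> (L + \<eta>) * (\<delta> * q (l - \<eta>))"
      proof (rule G_upper)
        show "x v \<le> L + \<eta>" if "u - r \<le> v" for v
          using T1[of v] s(4) e(2) \<open>s < u\<close> that by auto
        show "l - \<eta> \<le> x (u - \<sigma> j u)" if "j \<in> {1..m}" for j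
          using T1[of "u - \<sigma> j u"] s \<sigma>_le[OF that, of u] \<open>s < u\<close> by auto
      qed (use s that in auto)
      also have "\<dots> \<le> \<delta> * C \<eta>" using \<delta>_pos by (simp add: C_def mult.left_commute)
      finally show ?thesis .
    qed
    then have "x t \<le> C \<eta> + (x s - C \<eta>) * exp (- \<delta> * (B t - B s))"
      using s by (intro upper_comparison)
    also have "\<dots> \<le> C \<eta> + (K + \<eta> - C \<eta>) * exp (- \<delta> * (B t - B s))"
      using j(2) by (intro add_left_mono mult_right_mono) (auto simp: s_def)
    \<comment> \<open>Since \<open>C \<eta> \<ge> K + \<eta>\<close>, the coefficient is
      nonpositive, and shrinking the exponential raises the right side.\<close>
    also have "\<dots> \<le> C \<eta> + (K + \<eta> - C \<eta>) * exp (- \<delta> * (\<zeta> + \<eta>))"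
    proof -
      have "B t - B s < \<zeta> + \<eta>" using T1[of t] j(1) t(1) T(1) r_nonneg by (auto simp: s_def)
      then have "exp (- \<delta> * (\<zeta> + \<eta>)) \<le> exp (- \<delta> * (B t - B s))" using \<delta>_pos by simp
      then show ?thesis by (intro add_left_mono mult_left_mono_neg) (auto simp: C_def)
    qed
    finally show ?thesis using t(2) e(2) by simp
  qed
  \<comment> \<open>Now \<open>\<eta>\<close> tends to 0 from the right. The zeros stay unsimplified
    so that the limits have the shape produced by the limit rules.\<close>
  have q: "((\<lambda>\<eta>. q (l - \<eta>)) \<longlongrightarrow> q (l - 0)) (at_right 0)"
    by (intro isCont_tendsto_compose[OF isCont_q] tendsto_intros)
  have C: "(C \<longlongrightarrow> max ((L + 0) * q (l - 0)) (K + 0)) (at_right 0)"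
    unfolding C_def by (intro tendsto_intros q)
  have "L - 0 \<le> max ((L + 0) * q (l - 0)) (K + 0) +
      (K + 0 - max ((L + 0) * q (l - 0)) (K + 0)) * exp (- \<delta> * (\<zeta> + 0))"
  proof (rule tendsto_le[OF trivial_limit_at_right_real])
    show "((\<lambda>\<eta>. C \<eta> + (K + \<eta> - C \<eta>) * exp (- \<delta> * (\<zeta> + \<eta>))) \<longlongrightarrow>
      max ((L + 0) * q (l - 0)) (K + 0) +
      (K + 0 - max ((L + 0) * q (l - 0)) (K + 0)) * exp (- \<delta> * (\<zeta> + 0))) (at_right 0)"
      by (intro tendsto_intros C)
    show "((\<lambda>\<eta>. L - \<eta>) \<longlongrightarrow> L - 0) (at_right 0)" by (intro tendsto_intros)
    show "eventually (\<lambda>\<eta>. L - \<eta> \<le> C \<eta> + (K + \<eta> - C \<eta>) * exp (- \<delta> * (\<zeta> + \<eta>))) (at_right 0)"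
      using eventually_at_right_less[of "0::real"] by eventually_elim (rule main)
  qed
  then show ?thesis by simp
qed

text \<open>The mirror image of \<open>limsup_estimate\<close>: the minimum with \<open>K\<close>
  keeps the coefficient \<open>K - \<eta> - C \<eta>\<close> nonnegative, so shrinking the
  exponential lowers the bound.\<close>

lemma liminf_estimate:
  assumes lo: "\<And>e. e > 0 \<Longrightarrow> eventually (\<lambda>t. l - e < x t) at_top"
    and up: "\<And>e. e > 0 \<Longrightarrow> eventually (\<lambda>t. x t < L + e) at_top"
    and freq: "\<And>e S. e > 0 \<Longrightarrow> \<exists>t\<ge>S. x t < l + e" and "l > 0"
  shows "l \<ge> min (l * q L) K + (K - min (l * q L) K) * exp (- \<delta> * \<zeta>)"
proof -
  define C where "C = (\<lambda>\<eta>. min ((l - \<eta>) * q (L + \<eta>)) (K - \<eta>))"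
  have main: "l + \<eta> \<ge> C \<eta> + (K - \<eta> - C \<eta>) * exp (- \<delta> * (\<zeta> + \<eta>))" if \<eta>: "\<eta> > 0" for \<eta>
  proof -
    have "((\<lambda>e. (l - e) * q (K - \<eta>) - (l + e) - e / (\<delta> * b0)) \<longlongrightarrow>
        (l - 0) * q (K - \<eta>) - (l + 0) - 0 / (\<delta> * b0)) (at_right 0)"
      using \<delta>_pos b0_pos by (intro tendsto_intros) auto
    moreover have "l * 1 < l * q (K - \<eta>)"
      using q_strict_antimono[of "K - \<eta>" K] \<eta> \<open>l > 0\<close> q_K by (intro mult_strict_left_mono) auto
    ultimately have "eventually (\<lambda>e. (l - e) * q (K - \<eta>) - (l + e) - e / (\<delta> * b0) > 0) (at_right 0)"
      by (intro order_tendstoD(1)) auto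
    moreover have "eventually (\<lambda>e. e < \<eta>) (at_right 0)"
      using \<eta> by (intro order_tendstoD(2)[OF tendsto_ident_at]) auto
    ultimately have "eventually (\<lambda>e. 0 < e \<and> e < \<eta> \<and>
        (l - e) * q (K - \<eta>) - (l + e) - e / (\<delta> * b0) > 0) (at_right 0)"
      using eventually_at_right_less[of "0::real"] by eventually_elim auto
    then obtain e where e: "0 < e" "e < \<eta>" "(l - e) * q (K - \<eta>) - (l + e) - e / (\<delta> * b0) > 0"
      using eventually_happens'[OF trivial_limit_at_right_real] by blast
    have "eventually (\<lambda>t. l - e < x t \<and> x t < L + \<eta> \<and>
        (\<forall>j\<in>{1..m}. B t - B (t - \<sigma> j t) < \<zeta> + \<eta>)) at_top"
      using lo[OF e(1)] up[OF \<eta>] delay_eventually[OF \<eta>] by eventually_elim auto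
    then obtain T1 where T1: "\<And>t. t \<ge> T1 \<Longrightarrow> l - e < x t \<and> x t < L + \<eta> \<and>
        (\<forall>j\<in>{1..m}. B t - B (t - \<sigma> j t) < \<zeta> + \<eta>)"
      unfolding eventually_at_top_linorder by blast
    define T where "T = max T1 t0 + 2 * r"
    have T: "T1 + 2 * r \<le> T" "t0 + 2 * r \<le> T" by (auto simp: T_def)
    obtain t where t: "t > T" "x t < l + e" "\<beta> t * (G t - \<delta> * x t) \<le> e"
    proof -
      \<comment> \<open>Negation turns times near the lower limit into times near an upper limit,
        where \<open>fluctuation\<close> applies.\<close>
      have "\<exists>t>T. - x t > - (l + e) \<and> - (\<beta> t * (G t - \<delta> * x t)) \<ge> - e"
      proof (rule fluctuation[where f = "\<lambda>t. - x t" and f' = "\<lambda>t. - (\<beta> t * (G t - \<delta> * x t))"])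
        show "continuous_on {T..} (\<lambda>t. - x t)"
          using continuous_x[of T] T(2) r_nonneg by (auto intro!: continuous_intros)
        show "((\<lambda>t. - x t) has_real_derivative - (\<beta> t * (G t - \<delta> * x t))) (at t)" if "t > T" for t
          using that T(2) r_nonneg by (intro DERIV_minus x_deriv) auto
        show "\<exists>t\<ge>S. - x t > - (l + e)" for S using freq[OF e(1), of S] by auto
      qed (rule e(1))
      then show ?thesis using that by auto
    qed
    have "t \<ge> t0" using t(1) T(2) r_nonneg by simp
    have "G t - \<delta> * x t \<le> e / b0"
    proof -
      have "G t - \<delta> * x t \<le> e / \<beta> t"
        using t(3) \<beta>_pos[OF \<open>t \<ge> t0\<close>] by (simp add: field_simps)
      also have "\<dots> \<le> e / b0"
        using \<beta>_ge[OF \<open>t \<ge> t0\<close>] b0_pos e(1) by (simp add: frac_le)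
      finally show ?thesis .
    qed
    moreover have "\<delta> * x t < \<delta> * (l + e)" using t(2) \<delta>_pos by simp
    ultimately have G: "G t < \<delta> * (l + e) + e / b0" by linarith
    have "\<exists>j\<in>{1..m}. x (t - \<sigma> j t) \<ge> K - \<eta>"
    proof (rule ccontr)
      assume none: "\<not> ?thesis"
      have "\<delta> * (l + e) + e / b0 < (l - e) * (\<delta> * q (K - \<eta>))"
        using mult_strict_left_mono[OF e(3) \<delta>_pos] \<delta>_pos b0_pos by (simp add: algebra_simps)
      also have "\<dots> \<le> G t"
      proof (rule G_lower)
        show "l - e \<le> x v" if "t - r \<le> v" for v
          using T1[of v] t(1) T(1) r_nonneg that by auto
        show "x (t - \<sigma> j t) \<le> K - \<eta>" if "j \<in> {1..m}" for j
          using none that by (meson less_imp_le not_le)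
      qed (rule \<open>t \<ge> t0\<close>)
      finally show False using G by simp
    qed
    then obtain j where j: "j \<in> {1..m}" "x (t - \<sigma> j t) \<ge> K - \<eta>" by blast
    define s where "s = t - \<sigma> j t"
    have s: "s \<le> t" "t - s \<le> r" "t0 \<le> s" "T1 + r \<le> s"
      using \<sigma>_nonneg[OF j(1) \<open>t \<ge> t0\<close>] \<sigma>_le[OF j(1) \<open>t \<ge> t0\<close>] t(1) T r_nonneg by (auto simp: s_def)
    have "G u \<ge> \<delta> * C \<eta>" if "s < u" "u < t" for u
    proof -
      have "\<delta> * C \<eta> \<le> (l - \<eta>) * (\<delta> * q (L + \<eta>))" using \<delta>_pos by (simp add: C_def mult.left_commute)
      also have "\<dots> \<le> G u"
      proof (rule G_lower)
        show "l - \<eta> \<le> x v" if "u - r \<le> v" for v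
          using T1[of v] s(4) e(2) \<open>s < u\<close> that by auto
        show "x (u - \<sigma> j u) \<le> L + \<eta>" if "j \<in> {1..m}" for j
          using T1[of "u - \<sigma> j u"] s \<sigma>_le[OF that, of u] \<open>s < u\<close> by auto
      qed (use s that in auto)
      finally show ?thesis .
    qed
    then have "C \<eta> + (x s - C \<eta>) * exp (- \<delta> * (B t - B s)) \<le> x t"
      using s by (intro lower_comparison)
    moreover have "C \<eta> + (K - \<eta> - C \<eta>) * exp (- \<delta> * (B t - B s)) \<le>
        C \<eta> + (x s - C \<eta>) * exp (- \<delta> * (B t - B s))"
      using j(2) by (intro add_left_mono mult_right_mono) (auto simp: s_def)
    moreover have "C \<eta> + (K - \<eta> - C \<eta>) * exp (- \<delta> * (\<zeta> + \<eta>)) \<le>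
        C \<eta> + (K - \<eta> - C \<eta>) * exp (- \<delta> * (B t - B s))"
    proof -
      have "B t - B s < \<zeta> + \<eta>" using T1[of t] j(1) t(1) T(1) r_nonneg by (auto simp: s_def)
      then have "exp (- \<delta> * (\<zeta> + \<eta>)) \<le> exp (- \<delta> * (B t - B s))" using \<delta>_pos by simp
      then show ?thesis by (intro add_left_mono mult_left_mono) (auto simp: C_def)
    qed
    ultimately show ?thesis using t(2) e(2) by linarith
  qed
  have q: "((\<lambda>\<eta>. q (L + \<eta>)) \<longlongrightarrow> q (L + 0)) (at_right 0)"
    by (intro isCont_tendsto_compose[OF isCont_q] tendsto_intros)
  have C: "(C \<longlongrightarrow> min ((l - 0) * q (L + 0)) (K - 0)) (at_right 0)"
    unfolding C_def by (intro tendsto_intros q)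
  have "min ((l - 0) * q (L + 0)) (K - 0) +
      (K - 0 - min ((l - 0) * q (L + 0)) (K - 0)) * exp (- \<delta> * (\<zeta> + 0)) \<le> l + 0"
  proof (rule tendsto_le[OF trivial_limit_at_right_real])
    show "((\<lambda>\<eta>. C \<eta> + (K - \<eta> - C \<eta>) * exp (- \<delta> * (\<zeta> + \<eta>))) \<longlongrightarrow>
      min ((l - 0) * q (L + 0)) (K - 0) +
      (K - 0 - min ((l - 0) * q (L + 0)) (K - 0)) * exp (- \<delta> * (\<zeta> + 0))) (at_right 0)"
      by (intro tendsto_intros C)
    show "((\<lambda>\<eta>. l + \<eta>) \<longlongrightarrow> l + 0) (at_right 0)" by (intro tendsto_intros)
    show "eventually (\<lambda>\<eta>. C \<eta> + (K - \<eta> - C \<eta>) * exp (- \<delta> * (\<zeta> + \<eta>)) \<le> l + \<eta>) (at_right 0)"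
      using eventually_at_right_less[of "0::real"] by eventually_elim (rule main)
  qed
  then show ?thesis by simp
qed

section \<open>Comparison with a single exponential, and convergence\<close>

text \<open>The weights \<open>p j * exp (- a j * K)\<close> sum to \<open>\<delta>\<close>; the
  remaining factors \<open>exp (a j * (K - y))\<close> increase with \<open>a j\<close> because
  \<open>K - y\<close> is nonnegative.\<close>

lemma q_le_exp:
  assumes "\<And>j. j \<in> {1..m} \<Longrightarrow> a j \<le> A" "y \<le> K"
  shows "q y \<le> exp (A * (K - y))"
proof -
  have "(\<Sum>j=1..m. p j * exp (- a j * y)) \<le> (\<Sum>j=1..m. p j * exp (- a j * K) * exp (A * (K - y)))"
  proof (rule sum_mono)
    fix j assume j: "j \<in> {1..m}"
    have "p j * exp (- a j * y) = p j * exp (- a j * K) * exp (a j * (K - y))"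
      by (simp add: exp_add[symmetric] algebra_simps)
    also have "\<dots> \<le> p j * exp (- a j * K) * exp (A * (K - y))"
      using assms(1)[OF j] assms(2) p_pos[OF j] by (intro mult_left_mono) (auto intro!: mult_right_mono)
    finally show "p j * exp (- a j * y) \<le> p j * exp (- a j * K) * exp (A * (K - y))" .
  qed
  also have "\<dots> = \<delta> * exp (A * (K - y))" using K_eq by (simp add: sum_distrib_right[symmetric])
  finally show ?thesis using \<delta>_pos by (simp only: q_sum mult_le_cancel_left_pos)
qed

text \<open>For \<open>y\<close> above \<open>K\<close> the exponent \<open>a j * (K - y)\<close>
  decreases in \<open>a j\<close>, so the same \<open>A\<close> now gives a lower bound.\<close>

lemma q_ge_exp:
  assumes "\<And>j. j \<in> {1..m} \<Longrightarrow> a j \<le> A" "K \<le> y"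
  shows "exp (A * (K - y)) \<le> q y"
proof -
  have "\<delta> * exp (A * (K - y)) = (\<Sum>j=1..m. p j * exp (- a j * K) * exp (A * (K - y)))"
    using K_eq by (simp add: sum_distrib_right[symmetric])
  also have "\<dots> \<le> (\<Sum>j=1..m. p j * exp (- a j * y))"
  proof (rule sum_mono)
    fix j assume j: "j \<in> {1..m}"
    have "p j * exp (- a j * K) * exp (A * (K - y)) \<le> p j * exp (- a j * K) * exp (a j * (K - y))"
      using assms(1)[OF j] assms(2) p_pos[OF j] by (intro mult_left_mono) (auto intro!: mult_right_mono_neg)
    also have "\<dots> = p j * exp (- a j * y)"
      by (simp add: exp_add[symmetric] algebra_simps)
    finally show "p j * exp (- a j * K) * exp (A * (K - y)) \<le> p j * exp (- a j * y)" .
  qed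
  finally show ?thesis using \<delta>_pos by (simp only: q_sum mult_le_cancel_left_pos)
qed

lemma tendsto_equilibrium:
  assumes A: "\<And>j. j \<in> {1..m} \<Longrightarrow> a j \<le> A"
    and small: "A * K * (exp (\<delta> * \<zeta>) - 1) \<le> 1"
  shows "(x \<longlongrightarrow> K) at_top"
proof -
  obtain M where M: "\<And>t. t \<ge> t0 \<Longrightarrow> x t \<le> M" using bounded_above by blast
  obtain c where c: "c > 0" "\<And>t. t \<ge> t0 \<Longrightarrow> c \<le> x t" using bounded_below by blast
  obtain L where L: "c \<le> L" "\<And>e. e > 0 \<Longrightarrow> eventually (\<lambda>t. x t < L + e) at_top"
    "\<And>e S. e > 0 \<Longrightarrow> \<exists>t\<ge>S. x t > L - e"
    using ex_limsup[of t0 c x M] M c(2) by blast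
  obtain l' where l': "\<And>e. e > 0 \<Longrightarrow> eventually (\<lambda>t. - x t < l' + e) at_top"
    "\<And>e S. e > 0 \<Longrightarrow> \<exists>t\<ge>S. - x t > l' - e"
    using ex_limsup[of t0 "- M" "\<lambda>t. - x t" "- c"] M c(2) by (metis neg_le_iff_le)
  define l where "l = - l'"
  have lo: "eventually (\<lambda>t. l - e < x t) at_top" if "e > 0" for e
    using l'(1)[OF that] by eventually_elim (simp add: l_def)
  have freq: "\<exists>t\<ge>S. x t < l + e" if "e > 0" for e S
    using l'(2)[OF that, of S] by (auto simp: l_def)
  have "c \<le> l"
  proof (rule field_le_epsilon)
    fix e :: real assume "e > 0"
    then obtain t where "t \<ge> t0" "x t < l + e" using freq by blast
    then show "c \<le> l + e" using c(2)[of t] by simp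
  qed
  then have "l > 0" "L > 0" using c(1) L(1) by auto
  have "l \<le> L"
  proof (rule field_le_epsilon)
    fix e :: real assume e: "e > 0"
    obtain S where "\<And>t. t \<ge> S \<Longrightarrow> x t < L + e / 2"
      using L(2)[of "e / 2"] e unfolding eventually_at_top_linorder by auto
    moreover obtain S' where "\<And>t. t \<ge> S' \<Longrightarrow> l - e / 2 < x t"
      using lo[of "e / 2"] e unfolding eventually_at_top_linorder by auto
    ultimately have "l - e / 2 < L + e / 2" by (meson max.cobounded1 max.cobounded2 less_trans)
    then show "l \<le> L + e" by simp
  qed
  define \<theta> where "\<theta> = exp (- \<delta> * \<zeta>)"
  have \<theta>: "\<theta> > 0" "\<theta> \<le> 1" using \<delta>_pos \<zeta>_nonneg by (auto simp: \<theta>_def)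
  have upper: "L \<le> max (L * q l) K + (K - max (L * q l) K) * \<theta>"
    unfolding \<theta>_def by (rule limsup_estimate[OF lo L(2,3) \<open>L > 0\<close>])
  have lower: "l \<ge> min (l * q L) K + (K - min (l * q L) K) * \<theta>"
    unfolding \<theta>_def by (rule liminf_estimate[OF lo L(2) freq \<open>l > 0\<close>])
  \<comment> \<open>If \<open>K < l\<close>, then \<open>q l < 1\<close>, the maximum in
    \<open>upper\<close> is at most \<open>L\<close>, and \<open>upper\<close> collapses to
    \<open>L * \<theta> \<le> K * \<theta>\<close>, against \<open>K < l \<le> L\<close>. The proof
    of \<open>K \<le> L\<close> is dual.\<close>
  have "l \<le> K"
  proof (rule ccontr)
    assume "\<not> l \<le> K"
    then have "max (L * q l) K \<le> L"
      using q_strict_antimono[of K l] \<open>l \<le> L\<close> \<open>L > 0\<close> by (auto simp: q_K mult_le_cancel_left1)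
    then have "max (L * q l) K * (1 - \<theta>) \<le> L * (1 - \<theta>)" using \<theta> by (intro mult_right_mono) auto
    then have "L * \<theta> \<le> K * \<theta>" using upper by (simp add: algebra_simps)
    then show False using \<theta> \<open>\<not> l \<le> K\<close> \<open>l \<le> L\<close> by simp
  qed
  have "K \<le> L"
  proof (rule ccontr)
    assume "\<not> K \<le> L"
    then have "l \<le> min (l * q L) K"
      using q_strict_antimono[of L K] \<open>l \<le> L\<close> \<open>l > 0\<close> by (auto simp: q_K mult_le_cancel_left1)
    then have "l * (1 - \<theta>) \<le> min (l * q L) K * (1 - \<theta>)" using \<theta> by (intro mult_right_mono) auto
    then have "K * \<theta> \<le> l * \<theta>" using lower
      unfolding left_diff_distrib right_diff_distrib mult_1_right by linarith
    then show False using \<theta> \<open>\<not> K \<le> L\<close> \<open>l \<le> L\<close> by simp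
  qed
  \<comment> \<open>\<open>1 + \<rho>\<close> is the reciprocal of \<open>\<theta>\<close>.
    Multiplying both estimates by it removes \<open>\<theta>\<close> and leaves
    \<open>\<rho>\<close>, the quantity bounded in \<open>small\<close>.\<close>
  define \<rho> where "\<rho> = exp (\<delta> * \<zeta>) - 1"
  have \<rho>: "\<rho> \<ge> 0" "(1 + \<rho>) * \<theta> = 1"
    using \<delta>_pos \<zeta>_nonneg by (auto simp: \<rho>_def \<theta>_def exp_minus)
  have "A > 0" using A[of 1] a_pos[of 1] m_pos by simp
  have "q l \<ge> 1" using q_strict_antimono[of l K] \<open>l \<le> K\<close> by (cases "l = K") (auto simp: q_K)
  have "q L \<le> 1" using q_strict_antimono[of K L] \<open>K \<le> L\<close> by (cases "L = K") (auto simp: q_K)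
  have "L * 1 \<le> L * q l" using \<open>q l \<ge> 1\<close> \<open>L > 0\<close> by (intro mult_left_mono) auto
  then have "max (L * q l) K = L * q l" using \<open>K \<le> L\<close> by simp
  then have "L \<le> L * q l + (K - L * q l) * \<theta>" using upper by (simp only:)
  then have "(1 + \<rho>) * L \<le> (1 + \<rho>) * (L * q l + (K - L * q l) * \<theta>)" using \<rho>(1) by (intro mult_left_mono) auto
  also have "\<dots> = (1 + \<rho>) * (L * q l) + (K - L * q l) * ((1 + \<rho>) * \<theta>)" by algebra
  also have "\<dots> = \<rho> * (L * q l) + K" unfolding \<rho>(2) by (simp add: algebra_simps)
  finally have L_le: "L - K \<le> L * \<rho> * (q l - 1)" by (simp add: algebra_simps)
  have "l * q L \<le> l * 1" using \<open>q L \<le> 1\<close> \<open>l > 0\<close> by (intro mult_left_mono) auto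
  then have "min (l * q L) K = l * q L" using \<open>l \<le> K\<close> by simp
  then have "l \<ge> l * q L + (K - l * q L) * \<theta>" using lower by (simp only:)
  then have "(1 + \<rho>) * l \<ge> (1 + \<rho>) * (l * q L + (K - l * q L) * \<theta>)" using \<rho>(1) by (intro mult_left_mono) auto
  also have "(1 + \<rho>) * (l * q L + (K - l * q L) * \<theta>) = 
      (1 + \<rho>) * (l * q L) + (K - l * q L) * ((1 + \<rho>) * \<theta>)" by algebra
  also have "\<dots> = \<rho> * (l * q L) + K" unfolding \<rho>(2) by (simp add: algebra_simps)
  finally have l_ge: "K - l \<le> l * \<rho> * (1 - q L)" by (simp add: algebra_simps)
  \<comment> \<open>Since \<open>A * L = A * K + v\<close> and \<open>A * l = A * K - u\<close>,
    scaling by \<open>A\<close> brings both inequalities into the form of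
    \<open>scalar_two_cycle\<close>.\<close>
  define u v where "u = A * (K - l)" and "v = A * (L - K)"
  have "u = 0" "v = 0"
  proof -
    have "L - K \<le> L * \<rho> * (exp u - 1)"
      using q_le_exp[OF A \<open>l \<le> K\<close>] \<rho>(1) \<open>L > 0\<close>
      by (intro order_trans[OF L_le] mult_left_mono) (auto simp: u_def)
    then have "A * (L - K) \<le> A * (L * \<rho> * (exp u - 1))" using \<open>A > 0\<close> by (intro mult_left_mono) auto
    then have 1: "v \<le> (A * K + v) * \<rho> * (exp u - 1)" by (simp add: v_def algebra_simps)
    have "exp (- v) \<le> q L" using q_ge_exp[OF A \<open>K \<le> L\<close>] by (simp add: v_def algebra_simps)
    then have "K - l \<le> l * \<rho> * (1 - exp (- v))"
      using \<rho>(1) \<open>l > 0\<close> by (intro order_trans[OF l_ge] mult_left_mono) auto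
    then have "A * (K - l) \<le> A * (l * \<rho> * (1 - exp (- v)))" using \<open>A > 0\<close> by (intro mult_left_mono) auto
    then have 2: "u \<le> (A * K - u) * \<rho> * (1 - exp (- v))" by (simp add: u_def algebra_simps)
    have "u \<ge> 0" "v \<ge> 0" using \<open>A > 0\<close> \<open>l \<le> K\<close> \<open>K \<le> L\<close> by (auto simp: u_def v_def)
    with scalar_two_cycle[OF \<rho>(1) _ _ _ 1 2] small show "u = 0" "v = 0" by (auto simp: \<rho>_def)
  qed
  then have "l = K" "L = K" using \<open>A > 0\<close> by (auto simp: u_def v_def)
  show ?thesis
  proof (rule order_tendstoI)
    show "eventually (\<lambda>t. y < x t) at_top" if "y < K" for y
      using lo[of "K - y"] that \<open>l = K\<close> by simp
    show "eventually (\<lambda>t. x t < y) at_top" if "K < y" for y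
      using L(2)[of "y - K"] that \<open>L = K\<close> by simp
  qed
qed

end

section \<open>Reduction of the theorem to the locale\<close>

text \<open>The eventual bounds exclude infinite limits superior, which \<open>real_of_ereal\<close>
  would send to 0.\<close>

lemma real_of_ereal_Limsup_bounds:
  fixes f :: "real \<Rightarrow> real"
  assumes "eventually (\<lambda>t. c \<le> f t \<and> f t \<le> C) at_top"
  defines "z \<equiv> real_of_ereal (Limsup at_top (\<lambda>t. ereal (f t)))"
  shows "c \<le> z" "e > 0 \<Longrightarrow> eventually (\<lambda>t. f t < z + e) at_top"
proof -
  let ?z = "Limsup at_top (\<lambda>t. ereal (f t))"
  have "ereal c \<le> Liminf at_top (\<lambda>t. ereal (f t))"
    using assms(1) by (intro Liminf_bounded) (auto elim: eventually_mono)
  also have "\<dots> \<le> ?z" by (intro Liminf_le_Limsup) simp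
  finally have ge: "ereal c \<le> ?z" .
  have "?z \<le> ereal C"
    using assms(1) by (intro Limsup_bounded) (auto elim: eventually_mono)
  then have z: "?z = ereal z" using ge unfolding z_def by (cases ?z) auto
  show "c \<le> z" using ge unfolding z by simp
  show "eventually (\<lambda>t. f t < z + e) at_top" if "e > 0"
    using Limsup_lessD[of at_top "\<lambda>t. ereal (f t)" "ereal (z + e)"] that unfolding z by simp
qed

lemma integral_from_real_derivative:
  fixes f :: "real \<Rightarrow> real"
  assumes "continuous_on {c..} f" "t \<ge> c"
  shows "((\<lambda>t. integral {c..t} f) has_real_derivative f t) (at t within {c..})"
proof -
  have "((\<lambda>t. integral {c..t} f) has_real_derivative f t) (at t within {c..t + 1})"
    using assms by (intro integral_has_real_derivative continuous_on_subset[OF assms(1)]) auto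
  \<comment> \<open>The rule for integrals needs a compact interval; near \<open>t\<close> it agrees
    with the half-line, also at the endpoint \<open>t = c\<close>.\<close>
  moreover have "at t within {c..t + 1} = at t within {c..}"
    by (rule at_within_nhd[of t "{..<t + 1}"]) auto
  ultimately show ?thesis by simp
qed

lemma has_real_derivative_at_interior:
  assumes "(f has_real_derivative D) (at t within {c..})" "t > c"
  shows "(f has_real_derivative D) (at t)"
  using assms at_within_interior[of t "{c..}"] by simp

theorem theorem3p3:
  fixes t0 \<delta> K :: real
    and m :: nat
    and p a :: "nat \<Rightarrow> real"
    and \<beta> :: "real \<Rightarrow> real"
    and \<tau> \<sigma> :: "nat \<Rightarrow> real \<Rightarrow> real"
  assumes "m \<ge> 1"
    and "\<delta> > 0"
    and "\<And>j. j \<in> {1..m} \<Longrightarrow> p j > 0"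
    and "\<And>j. j \<in> {1..m} \<Longrightarrow> a j > 0"
    and "continuous_on {t0..} \<beta>"
    and "\<And>t. t \<ge> t0 \<Longrightarrow> \<beta> t \<ge> 0"
    and "bounded (\<beta> ` {t0..})"
    and "(INF t\<in>{t0..}. \<beta> t) > 0"
    and "\<And>j. j \<in> {1..m} \<Longrightarrow> continuous_on {t0..} (\<tau> j)"
    and "\<And>j t. j \<in> {1..m} \<Longrightarrow> t \<ge> t0 \<Longrightarrow> \<tau> j t \<ge> 0"
    and "\<And>j. j \<in> {1..m} \<Longrightarrow> bounded (\<tau> j ` {t0..})"
    and "\<And>j. j \<in> {1..m} \<Longrightarrow> continuous_on {t0..} (\<sigma> j)"
    and "\<And>j t. j \<in> {1..m} \<Longrightarrow> t \<ge> t0 \<Longrightarrow> \<sigma> j t \<ge> 0"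
    and "\<And>j. j \<in> {1..m} \<Longrightarrow> bounded (\<sigma> j ` {t0..})"
    and "(\<Sum>j=1..m. p j) > \<delta>"
    and "K > 0"
    and "(\<Sum>j=1..m. p j * exp (- a j * K)) = \<delta>"
    and "Max (a ` {1..m}) / Min (a ` {1..m}) < 3 / 2"
    and "Max (a ` {1..m}) * K * (exp (\<delta> * zeta_M m \<beta> \<sigma>) - 1) \<le> 1"
  shows "globally_attractive t0 m \<beta> p a \<delta> \<tau> \<sigma> K"
  unfolding globally_attractive_def
proof (intro ballI allI impI)
  fix \<phi> x
  define r where "r = max_delay t0 m \<tau> \<sigma>"
  assume "\<phi> \<in> admissible_initial (max_delay t0 m \<tau> \<sigma>)"
    and "nicholson_solution t0 m \<beta> p a \<delta> \<tau> \<sigma> \<phi> x"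
  then have \<phi>: "continuous_on {- r..0} \<phi>" "\<And>\<theta>. - r \<le> \<theta> \<Longrightarrow> \<theta> < 0 \<Longrightarrow> \<phi> \<theta> \<ge> 0" "\<phi> 0 > 0"
    and init: "\<And>\<theta>. - r \<le> \<theta> \<Longrightarrow> \<theta> \<le> 0 \<Longrightarrow> x (t0 + \<theta>) = \<phi> \<theta>"
    and deriv: "\<And>t. t \<ge> t0 \<Longrightarrow> (x has_real_derivative
        \<beta> t * ((\<Sum>j=1..m. p j * x (t - \<tau> j t) * exp (- a j * x (t - \<sigma> j t))) - \<delta> * x t))
        (at t within {t0..})"
    unfolding r_def admissible_initial_def nicholson_solution_def by auto
  have delay_le: "\<tau> j t \<le> r" "\<sigma> j t \<le> r" if j: "j \<in> {1..m}" and t: "t \<ge> t0" for j t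
  proof -
    have "\<tau> j t \<le> (SUP t\<in>{t0..}. \<tau> j t)" "\<sigma> j t \<le> (SUP t\<in>{t0..}. \<sigma> j t)"
      using assms(11,14)[OF j] t by (auto intro!: cSUP_upper bounded_imp_bdd_above)
    moreover have "max (SUP t\<in>{t0..}. \<tau> j t) (SUP t\<in>{t0..}. \<sigma> j t) \<le> r"
      unfolding r_def max_delay_def using j by (intro Max_ge) auto
    ultimately show "\<tau> j t \<le> r" "\<sigma> j t \<le> r" by auto
  qed
  have "r \<ge> 0" using delay_le(1)[of 1 t0] assms(10)[of 1 t0] assms(1) by simp
  define b0 where "b0 = (INF t\<in>{t0..}. \<beta> t)"
  have b0: "b0 \<le> \<beta> t" if "t \<ge> t0" for t
    unfolding b0_def using assms(7) that by (auto intro!: cINF_lower bounded_imp_bdd_below)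
  obtain b1 where b1: "\<And>t. t \<ge> t0 \<Longrightarrow> \<beta> t \<le> b1"
    using bounded_imp_bdd_above[OF assms(7)] unfolding bdd_above_def by auto
  define B where "B = (\<lambda>t. integral {t0..t} \<beta>)"
  have B: "(B has_real_derivative \<beta> t) (at t within {t0..})" if "t \<ge> t0" for t
    unfolding B_def using assms(5) that by (rule integral_from_real_derivative)
  have int: "\<beta> integrable_on {s..t}" if "t0 \<le> s" for s t
    by (rule integrable_continuous_real, rule continuous_on_subset[OF assms(5)]) (use that in auto)
  \<comment> \<open>This turns the integrals inside \<open>zeta_M\<close> into the increments of
    \<open>B\<close> used by the locale.\<close>
  have B_diff: "integral {s..t} \<beta> = B t - B s" if "t0 \<le> s" "s \<le> t" for s t
    using Henstock_Kurzweil_Integration.integral_combine[OF that int[of t0 t]] by (simp add: B_def)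
  define I where "I = (\<lambda>j t. integral {t - \<sigma> j t..t} \<beta>)"
  \<comment> \<open>From \<open>t0 + r\<close> on the interval of integration lies in the half-line
    where \<open>\<beta>\<close> is controlled.\<close>
  have I_bounds: "0 \<le> I j t \<and> I j t \<le> b1 * r" if j: "j \<in> {1..m}" and t: "t \<ge> t0 + r" for j t
  proof -
    have \<sigma>: "0 \<le> \<sigma> j t" "\<sigma> j t \<le> r" using assms(13)[OF j] delay_le(2)[OF j] t \<open>r \<ge> 0\<close> by auto
    have ge: "u \<ge> t0" if "u \<ge> t - \<sigma> j t" for u using that \<sigma> t by simp
    have "I j t \<le> integral {t - \<sigma> j t..t} (\<lambda>_. b1)"
      unfolding I_def using b1 ge \<sigma> by (intro integral_le int) auto
    also have "\<dots> = b1 * \<sigma> j t" using \<sigma> by simp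
    also have "\<dots> \<le> b1 * r"
      using \<sigma> b1[of t0] assms(6)[of t0] by (intro mult_left_mono) auto
    finally show ?thesis
      unfolding I_def using assms(6) ge by (auto intro!: integral_nonneg int)
  qed
  define z where "z = (\<lambda>j. real_of_ereal (Limsup at_top (\<lambda>t. ereal (I j t))))"
  have I_ev: "eventually (\<lambda>t. 0 \<le> I j t \<and> I j t \<le> b1 * r) at_top" if "j \<in> {1..m}" for j
    using eventually_ge_at_top[of "t0 + r"] by eventually_elim (rule I_bounds[OF that])
  have z: "z j \<le> zeta_M m \<beta> \<sigma>" if "j \<in> {1..m}" for j
    unfolding zeta_M_def z_def I_def using that by (intro Max_ge) auto
  interpret nicholson t0 r \<delta> K b0 b1 "zeta_M m \<beta> \<sigma>" m p a \<beta> B \<tau> \<sigma> x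
  proof
    show "0 \<le> zeta_M m \<beta> \<sigma>"
      using z[of 1] real_of_ereal_Limsup_bounds(1)[OF I_ev[of 1]] assms(1) by (auto simp: z_def)
    show "eventually (\<lambda>t. B t - B (t - \<sigma> j t) < zeta_M m \<beta> \<sigma> + e) at_top"
      if j: "j \<in> {1..m}" and "e > 0" for j e
    proof -
      have "eventually (\<lambda>t. I j t < z j + e) at_top"
        unfolding z_def using real_of_ereal_Limsup_bounds(2)[OF I_ev[OF j] \<open>e > 0\<close>] .
      then show ?thesis using eventually_ge_at_top[of "t0 + r"]
      proof eventually_elim
        case (elim t)
        have "I j t = B t - B (t - \<sigma> j t)"
          unfolding I_def using assms(13)[OF j, of t] delay_le(2)[OF j, of t] elim(2) \<open>r \<ge> 0\<close>
          by (intro B_diff) auto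
        then show ?case using elim(1) z[OF j] by simp
      qed
    qed
    show "continuous_on {t0..} B"
      using B by (auto intro!: continuous_on_eq_continuous_within[THEN iffD2] DERIV_continuous)
    show "(B has_real_derivative \<beta> t) (at t)" if "t > t0" for t
      using B[of t] that by (intro has_real_derivative_at_interior[of B _ t t0]) auto
    show "(x has_real_derivative
        \<beta> t * ((\<Sum>j=1..m. p j * x (t - \<tau> j t) * exp (- a j * x (t - \<sigma> j t))) - \<delta> * x t)) (at t)"
      if "t > t0" for t
      using deriv[of t] that by (intro has_real_derivative_at_interior[of x _ t t0]) auto
    \<comment> \<open>Continuity of \<open>x\<close> is glued at \<open>t0\<close> from the initial
      function on the left and differentiability on the right.\<close>
    have "continuous_on {t0 - r..t0} (\<lambda>t. \<phi> (t - t0))"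
      by (intro continuous_on_compose2[OF \<phi>(1)] continuous_intros) auto
    then have "continuous_on {t0 - r..t0} x"
      by (rule continuous_on_eq) (use init[of "t - t0" for t] in \<open>auto simp: algebra_simps\<close>)
    moreover have "continuous_on {t0..} x"
      using deriv by (auto intro!: continuous_on_eq_continuous_within[THEN iffD2] DERIV_continuous)
    ultimately have "continuous_on ({t0 - r..t0} \<union> {t0..}) x"
      by (intro continuous_on_closed_Un) auto
    then show "continuous_on {t0 - r..} x"
      by (rule continuous_on_subset) auto
    show "x t \<ge> 0" if "t0 - r \<le> t" "t \<le> t0" for t
      using init[of "t - t0"] \<phi>(2)[of "t - t0"] \<phi>(3) that by (cases "t = t0") auto
    show "x t0 > 0" using init[of 0] \<phi>(3) \<open>r \<ge> 0\<close> by simp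
  qed (use assms b0 b1 delay_le \<open>r \<ge> 0\<close> in \<open>auto simp: b0_def\<close>)
  show "(x \<longlongrightarrow> K) at_top"
  proof (rule tendsto_equilibrium)
    show "a j \<le> Max (a ` {1..m})" if "j \<in> {1..m}" for j using that by (intro Max_ge) auto
  qed (rule assms(19))
qed

end
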